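(* Let $p$ be a prime number. Any irrational $p$-adic number $\xi$ satisfies $$\widehat{\mu}^{\times}(\xi) \leq 3 +\frac{2}{\mu^{\times}(\xi)- 2},$$ $$\mu^{\times}(\xi) \geq \widehat{\mu}^{\times}(\xi)^2 - 3 \widehat{\mu}^{\times}(\xi) + 3,$$ and $$\widehat{\mu}^{\times}(\xi) \leq \frac{5+\sqrt{5}}{2}.$$ (In the first inequality, the right-hand side is interpreted as $3$ if $\mu^\times(\xi)=\infty$ and as $+\infty$ if $\mu^\times(\xi)=2$.)
   Context: $|\cdot|_p$ is the $p$-adic absolute value with $|p|_p=p^{-1}$. For an irrational $p$-adic number $\xi$: $\mu^{\times}(\xi)$ is the supremum of the real numbers $\mu^\times$ for which $0 < |y\xi - x|_p \le (|xy|^{1/2})^{-\mu^\times}$ has infinitely many solutions in nonzero integers $x,y$; $\widehat{\mu}^{\times}(\xi)$ is the supremum of the real numbers $\widehat{\mu}^\times$ such that for every sufficiently large real $X$ the system $0 < |xy|^{1/2} \le X$, $|y\xi - x|_p \le X^{-\widehat{\mu}^\times}$ has a solution in integers $x,y$ (not required to be coprime). *)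

theory Defs
  imports "HOL-Analysis.Analysis" "HOL-Algebra.QuotRing"
begin

section \<open>The field of $p$-adic numbers\<close>

subsection \<open>The $p$-adic absolute value on the rationals\<close>

definition padic_val :: "nat \<Rightarrow> rat \<Rightarrow> int" where
  "padic_val p q = (case quotient_of q of (a, b) \<Rightarrow>
     int (multiplicity (int p) a) - int (multiplicity (int p) b))"

definition padic_abs :: "nat \<Rightarrow> rat \<Rightarrow> real" where
  "padic_abs p q = (if q = 0 then 0 else real p powi (- padic_val p q))"

lemma padic_val_of_int_divide:
  assumes p: "prime p" and "a \<noteq> 0" "b \<noteq> 0"
  shows "padic_val p (of_int a / of_int b) =
    int (multiplicity (int p) a) - int (multiplicity (int p) b)"
proof -
  obtain c d where cd: "quotient_of (of_int a / of_int b) = (c, d)"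
    by (cases "quotient_of (of_int a / of_int b)")
  have "d > 0" by (rule quotient_of_denom_pos[OF cd])
  have eq: "of_int a / of_int b = (of_int c / of_int d :: rat)"
    by (rule quotient_of_div[OF cd])
  then have "of_int (a * d) = (of_int (c * b) :: rat)"
    using assms(3) \<open>d > 0\<close> by (simp add: field_simps)
  then have ad: "a * d = c * b" by (simp only: of_int_eq_iff)
  then have "c \<noteq> 0" using assms(2) \<open>d > 0\<close> by auto
  have pe: "prime_elem (int p)" using p by simp
  have "multiplicity (int p) a + multiplicity (int p) d
      = multiplicity (int p) c + multiplicity (int p) b"
    using ad assms(2,3) \<open>c \<noteq> 0\<close> \<open>d > 0\<close>
      prime_elem_multiplicity_mult_distrib[OF pe, of a d]
      prime_elem_multiplicity_mult_distrib[OF pe, of c b] by simp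
  then show ?thesis using cd by (simp add: padic_val_def)
qed

lemma rat_common_denominator:
  fixes q r :: rat
  obtains a c b where "q = of_int a / of_int b" "r = of_int c / of_int b" "b \<noteq> 0"
proof -
  obtain a1 b1 where 1: "quotient_of q = (a1, b1)" by (cases "quotient_of q")
  obtain a2 b2 where 2: "quotient_of r = (a2, b2)" by (cases "quotient_of r")
  have pos: "b1 > 0" "b2 > 0" using quotient_of_denom_pos 1 2 by blast+
  show ?thesis
    by (rule that[of "a1 * b2" "b1 * b2" "a2 * b1"])
      (use pos quotient_of_div[OF 1] quotient_of_div[OF 2] in auto)
qed

lemma padic_abs_0 [simp]: "padic_abs p 0 = 0"
  by (simp add: padic_abs_def)

lemma padic_abs_1 [simp]: "padic_abs p 1 = 1"
  by (simp add: padic_abs_def padic_val_def)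

lemma padic_abs_p:
  assumes "prime p"
  shows "padic_abs p (of_nat p) = 1 / real p"
proof -
  have "prime_elem (int p)" "p \<noteq> 0" using assms by auto
  then have "padic_val p (of_int (int p) / of_int 1) = 1"
    by (subst padic_val_of_int_divide[OF assms]) auto
  then show ?thesis using \<open>p \<noteq> 0\<close>
    by (simp add: padic_abs_def power_int_minus field_simps)
qed

lemma padic_abs_nonneg [simp]: "padic_abs p q \<ge> 0"
  by (simp add: padic_abs_def)

lemma padic_abs_eq_0_iff:
  assumes "prime p"
  shows "padic_abs p q = 0 \<longleftrightarrow> q = 0"
  using prime_gt_0_nat[OF assms] by (simp add: padic_abs_def)

lemma padic_abs_minus [simp]: "padic_abs p (- q) = padic_abs p q"
proof (cases "q = 0")
  case False
  have "multiplicity (int p) (- a) = multiplicity (int p) a" for a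
    by (simp add: multiplicity_def)
  then show ?thesis using False
    by (simp add: padic_abs_def padic_val_def rat_uminus_code Let_def split: prod.splits)
qed simp

lemma padic_abs_minus_commute: "padic_abs p (q - r) = padic_abs p (r - q)"
  using padic_abs_minus[of p "q - r"] by simp

lemma padic_abs_mult:
  assumes p: "prime p"
  shows "padic_abs p (q * r) = padic_abs p q * padic_abs p r"
proof (cases "q = 0 \<or> r = 0")
  case True
  then show ?thesis by auto
next
  case False
  obtain a c b where abc: "q = of_int a / of_int b" "r = of_int c / of_int b" "b \<noteq> 0"
    by (rule rat_common_denominator)
  have nz: "a \<noteq> 0" "c \<noteq> 0" using False abc by auto
  have pe: "prime_elem (int p)" using p by simp
  have "q * r = of_int (a * c) / of_int (b * b)" using abc by simp
  then have "padic_val p (q * r) =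
      int (multiplicity (int p) (a * c)) - int (multiplicity (int p) (b * b))"
    using padic_val_of_int_divide[OF p, of "a * c" "b * b"] nz abc by simp
  also have "\<dots> = padic_val p q + padic_val p r"
    using nz abc padic_val_of_int_divide[OF p]
    by (simp add: prime_elem_multiplicity_mult_distrib[OF pe])
  finally show ?thesis
    using False prime_gt_0_nat[OF p] by (simp add: padic_abs_def power_int_diff power_int_minus divide_inverse)
qed

lemma padic_abs_inverse:
  assumes "prime p"
  shows "padic_abs p (inverse q) = inverse (padic_abs p q)"
proof (cases "q = 0")
  case False
  then have "padic_abs p q * padic_abs p (inverse q) = 1"
    by (simp flip: padic_abs_mult[OF assms])
  then show ?thesis by (metis inverse_unique)
qed simp

lemma padic_abs_add:
  assumes p: "prime p"
  shows "padic_abs p (q + r) \<le> max (padic_abs p q) (padic_abs p r)"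
proof (cases "q = 0 \<or> r = 0 \<or> q + r = 0")
  case True
  then show ?thesis by (auto simp: max_def)
next
  case False
  obtain a c b where abc: "q = of_int a / of_int b" "r = of_int c / of_int b" "b \<noteq> 0"
    by (rule rat_common_denominator)
  have s: "q + r = of_int (a + c) / of_int b" using abc by (simp add: add_divide_distrib)
  have nz: "a \<noteq> 0" "c \<noteq> 0" "a + c \<noteq> 0" using False abc s by auto
  let ?m = "multiplicity (int p)"
  have nu: "\<not> is_unit (int p)" using p not_prime_unit by auto
  have "int p ^ min (?m a) (?m c) dvd a + c"
    by (intro dvd_add multiplicity_dvd') auto
  then have "min (?m a) (?m c) \<le> ?m (a + c)"
    by (intro multiplicity_geI) (use nz nu in auto)
  then have "padic_val p q \<le> padic_val p (q + r) \<or> padic_val p r \<le> padic_val p (q + r)"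
    using padic_val_of_int_divide[OF p nz(1) abc(3)] padic_val_of_int_divide[OF p nz(2) abc(3)]
      padic_val_of_int_divide[OF p nz(3) abc(3)]
    unfolding s unfolding abc(1,2) by linarith
  moreover have "1 \<le> real p" using prime_gt_0_nat[OF p] by simp
  ultimately show ?thesis using False
    by (auto simp: padic_abs_def le_max_iff_disj intro: power_int_increasing)
qed

lemma padic_abs_diff:
  assumes "prime p"
  shows "padic_abs p (q - r) \<le> max (padic_abs p q) (padic_abs p r)"
  using padic_abs_add[OF assms, of q "- r"] by simp

lemma padic_abs_triangle_diff:
  assumes "prime p"
  shows "\<bar>padic_abs p q - padic_abs p r\<bar> \<le> padic_abs p (q - r)"
proof -
  have "padic_abs p u \<le> padic_abs p v + padic_abs p (u - v)" for u v
  proof -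
    have "padic_abs p u \<le> max (padic_abs p v) (padic_abs p (u - v))"
      using padic_abs_add[OF assms, of v "u - v"] by simp
    also have "\<dots> \<le> padic_abs p v + padic_abs p (u - v)" by (simp add: max_def)
    finally show ?thesis .
  qed
  from this[of q r] this[of r q] show ?thesis
    unfolding padic_abs_minus_commute[of p r q] by linarith
qed


subsection \<open>Completion\<close>

text \<open>The field of $p$-adic numbers is the completion of the rationals with respect to
  the $p$-adic absolute value: the ring of Cauchy sequences (with pointwise operations)
  modulo the ideal of null sequences.\<close>

definition padic_Cauchy :: "nat \<Rightarrow> (nat \<Rightarrow> rat) \<Rightarrow> bool" where
  "padic_Cauchy p s \<longleftrightarrow> (\<forall>e>0. \<exists>N. \<forall>m\<ge>N. \<forall>n\<ge>N. padic_abs p (s m - s n) < e)"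

definition padic_Cauchy_ring :: "nat \<Rightarrow> (nat \<Rightarrow> rat) ring" where
  "padic_Cauchy_ring p = \<lparr>carrier = {s. padic_Cauchy p s},
     mult = (\<lambda>s t n. s n * t n), one = (\<lambda>n. 1), zero = (\<lambda>n. 0), add = (\<lambda>s t n. s n + t n)\<rparr>"

definition padic_null :: "nat \<Rightarrow> (nat \<Rightarrow> rat) set" where
  "padic_null p = {s. (\<lambda>n. padic_abs p (s n)) \<longlonglongrightarrow> 0}"

definition Qp :: "nat \<Rightarrow> (nat \<Rightarrow> rat) set ring" where
  "Qp p = padic_Cauchy_ring p Quot padic_null p"

definition padic_of_rat :: "nat \<Rightarrow> rat \<Rightarrow> (nat \<Rightarrow> rat) set" where
  "padic_of_rat p q = padic_null p +>\<^bsub>padic_Cauchy_ring p\<^esub> (\<lambda>n. q)"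

text \<open>The absolute value of a class is the common limit along any of its representatives;
  it exists by \<open>padic_norm_tendsto\<close> below.\<close>

definition padic_norm :: "nat \<Rightarrow> (nat \<Rightarrow> rat) set \<Rightarrow> real" where
  "padic_norm p \<alpha> = (THE r. \<forall>s\<in>\<alpha>. (\<lambda>n. padic_abs p (s n)) \<longlonglongrightarrow> r)"

lemma padic_Cauchy_ring_simps [simp]:
  "carrier (padic_Cauchy_ring p) = {s. padic_Cauchy p s}"
  "mult (padic_Cauchy_ring p) = (\<lambda>s t n. s n * t n)"
  "one (padic_Cauchy_ring p) = (\<lambda>n. 1)"
  "zero (padic_Cauchy_ring p) = (\<lambda>n. 0)"
  "add (padic_Cauchy_ring p) = (\<lambda>s t n. s n + t n)"
  by (simp_all add: padic_Cauchy_ring_def)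

lemma padic_Cauchy_const [simp]: "padic_Cauchy p (\<lambda>n. q)"
  by (simp add: padic_Cauchy_def)

lemma padic_Cauchy_add:
  assumes p: "prime p" and s: "padic_Cauchy p s" and t: "padic_Cauchy p t"
  shows "padic_Cauchy p (\<lambda>n. s n + t n)"
  unfolding padic_Cauchy_def
proof (intro allI impI)
  fix e :: real assume "e > 0"
  then obtain M N where M: "\<forall>m\<ge>M. \<forall>n\<ge>M. padic_abs p (s m - s n) < e"
    and N: "\<forall>m\<ge>N. \<forall>n\<ge>N. padic_abs p (t m - t n) < e"
    using s t unfolding padic_Cauchy_def by metis
  have "padic_abs p (s m + t m - (s n + t n)) < e" if "m \<ge> max M N" "n \<ge> max M N" for m n
  proof -
    have "padic_abs p (s m - s n) < e" "padic_abs p (t m - t n) < e"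
      using M N that by simp_all
    moreover have "s m + t m - (s n + t n) = (s m - s n) + (t m - t n)" by simp
    ultimately show ?thesis using padic_abs_add[OF p, of "s m - s n" "t m - t n"]
      by (simp only: max_def split: if_splits)
  qed
  then show "\<exists>N. \<forall>m\<ge>N. \<forall>n\<ge>N. padic_abs p (s m + t m - (s n + t n)) < e" by blast
qed

lemma padic_Cauchy_uminus: "padic_Cauchy p s \<Longrightarrow> padic_Cauchy p (\<lambda>n. - s n)"
proof -
  have "padic_abs p (- s m - - s n) = padic_abs p (s m - s n)" for m n
    using padic_abs_minus_commute[of p "s m" "s n"] by simp
  then show "padic_Cauchy p s \<Longrightarrow> padic_Cauchy p (\<lambda>n. - s n)"
    unfolding padic_Cauchy_def by simp
qed

lemma padic_Cauchy_abs_convergent: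
  assumes p: "prime p" and s: "padic_Cauchy p s"
  shows "convergent (\<lambda>n. padic_abs p (s n))"
proof -
  have "Cauchy (\<lambda>n. padic_abs p (s n))"
  proof (rule metric_CauchyI)
    fix e :: real assume "e > 0"
    then obtain M where M: "\<forall>m\<ge>M. \<forall>n\<ge>M. padic_abs p (s m - s n) < e"
      using s unfolding padic_Cauchy_def by metis
    have "dist (padic_abs p (s m)) (padic_abs p (s n)) < e" if "m \<ge> M" "n \<ge> M" for m n
      using padic_abs_triangle_diff[OF p, of "s m" "s n"] M that
      unfolding dist_real_def by (metis le_less_trans)
    then show "\<exists>M. \<forall>m\<ge>M. \<forall>n\<ge>M. dist (padic_abs p (s m)) (padic_abs p (s n)) < e" by blast
  qed
  then show ?thesis by (simp add: Cauchy_convergent_iff)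
qed

lemma padic_Cauchy_bounded:
  assumes p: "prime p" and s: "padic_Cauchy p s"
  obtains B where "B > 0" "\<And>n. padic_abs p (s n) \<le> B"
proof -
  have "Bseq (\<lambda>n. padic_abs p (s n))"
    using padic_Cauchy_abs_convergent[OF assms] by (rule convergent_imp_Bseq)
  then obtain B where "B > 0" "\<forall>n. norm (padic_abs p (s n)) \<le> B" by (auto elim: BseqE)
  then show ?thesis using that by simp
qed

lemma padic_Cauchy_mult:
  assumes p: "prime p" and s: "padic_Cauchy p s" and t: "padic_Cauchy p t"
  shows "padic_Cauchy p (\<lambda>n. s n * t n)"
  unfolding padic_Cauchy_def
proof (intro allI impI)
  fix e :: real assume e: "e > 0"
  obtain A where A: "A > 0" "\<And>n. padic_abs p (s n) \<le> A"
    using padic_Cauchy_bounded[OF p s] by blast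
  obtain B where B: "B > 0" "\<And>n. padic_abs p (t n) \<le> B"
    using padic_Cauchy_bounded[OF p t] by blast
  have "e / B > 0" "e / A > 0" using e A B by simp_all
  then obtain M N where M: "\<forall>m\<ge>M. \<forall>n\<ge>M. padic_abs p (s m - s n) < e / B"
    and N: "\<forall>m\<ge>N. \<forall>n\<ge>N. padic_abs p (t m - t n) < e / A"
    using s t unfolding padic_Cauchy_def by metis
  have "padic_abs p (s m * t m - s n * t n) < e" if "m \<ge> max M N" "n \<ge> max M N" for m n
  proof -
    have "padic_abs p (s m - s n) * padic_abs p (t m) \<le> padic_abs p (s m - s n) * B"
      using B by (intro mult_left_mono) auto
    also have "\<dots> < e" using M that B by (simp add: field_simps)
    finally have 1: "padic_abs p ((s m - s n) * t m) < e" by (simp add: padic_abs_mult[OF p])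
    have "padic_abs p (s n) * padic_abs p (t m - t n) \<le> A * padic_abs p (t m - t n)"
      using A by (intro mult_right_mono) auto
    also have "\<dots> < e" using N that A by (simp add: field_simps)
    finally have 2: "padic_abs p (s n * (t m - t n)) < e" by (simp add: padic_abs_mult[OF p])
    have "s m * t m - s n * t n = (s m - s n) * t m + s n * (t m - t n)"
      by (simp add: algebra_simps)
    then show ?thesis using 1 2 padic_abs_add[OF p, of "(s m - s n) * t m" "s n * (t m - t n)"]
      by (simp only: max_def split: if_splits)
  qed
  then show "\<exists>N. \<forall>m\<ge>N. \<forall>n\<ge>N. padic_abs p (s m * t m - s n * t n) < e" by blast
qed

lemma cring_padic_Cauchy_ring:
  assumes p: "prime p"
  shows "cring (padic_Cauchy_ring p)"
proof (rule cringI)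
  show "abelian_group (padic_Cauchy_ring p)"
  proof (rule abelian_groupI)
    fix s assume "s \<in> carrier (padic_Cauchy_ring p)"
    then show "\<exists>t\<in>carrier (padic_Cauchy_ring p).
        t \<oplus>\<^bsub>padic_Cauchy_ring p\<^esub> s = \<zero>\<^bsub>padic_Cauchy_ring p\<^esub>"
      by (intro bexI[of _ "\<lambda>n. - s n"]) (auto intro: padic_Cauchy_uminus)
  qed (auto simp: padic_Cauchy_add[OF p] algebra_simps)
  show "comm_monoid (padic_Cauchy_ring p)"
    by (rule comm_monoidI) (auto simp: padic_Cauchy_mult[OF p] algebra_simps)
qed (auto simp: algebra_simps)

lemma padic_null_imp_Cauchy:
  assumes p: "prime p" and s: "s \<in> padic_null p"
  shows "padic_Cauchy p s"
  unfolding padic_Cauchy_def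
proof (intro allI impI)
  fix e :: real assume "e > 0"
  then obtain N where N: "\<forall>n\<ge>N. padic_abs p (s n) < e"
    using s by (force simp: padic_null_def lim_sequentially)
  have "padic_abs p (s m - s n) < e" if "m \<ge> N" "n \<ge> N" for m n
  proof -
    have "padic_abs p (s m) < e" "padic_abs p (s n) < e" using N that by simp_all
    then show ?thesis using padic_abs_diff[OF p, of "s m" "s n"]
      by (simp only: max_def split: if_splits)
  qed
  then show "\<exists>N. \<forall>m\<ge>N. \<forall>n\<ge>N. padic_abs p (s m - s n) < e" by blast
qed

lemma padic_null_mult:
  assumes p: "prime p" and s: "s \<in> padic_null p" and t: "padic_Cauchy p t"
  shows "(\<lambda>n. s n * t n) \<in> padic_null p"
proof -
  obtain l where l: "(\<lambda>n. padic_abs p (t n)) \<longlonglongrightarrow> l"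
    using padic_Cauchy_abs_convergent[OF p t] by (auto simp: convergent_def)
  have "(\<lambda>n. padic_abs p (s n) * padic_abs p (t n)) \<longlonglongrightarrow> 0 * l"
    using s l by (intro tendsto_mult) (auto simp: padic_null_def)
  then show ?thesis by (simp add: padic_null_def padic_abs_mult[OF p])
qed

lemma padic_null_add:
  assumes p: "prime p" and s: "s \<in> padic_null p" and t: "t \<in> padic_null p"
  shows "(\<lambda>n. s n + t n) \<in> padic_null p"
proof -
  have "(\<lambda>n. max (padic_abs p (s n)) (padic_abs p (t n))) \<longlonglongrightarrow> max 0 0"
    using s t by (intro tendsto_max) (auto simp: padic_null_def)
  then have lim: "(\<lambda>n. max (padic_abs p (s n)) (padic_abs p (t n))) \<longlonglongrightarrow> 0" by simp
  have "(\<lambda>n. padic_abs p (s n + t n)) \<longlonglongrightarrow> 0"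
    by (rule tendsto_sandwich[OF _ _ tendsto_const lim]) (auto simp: padic_abs_add[OF p])
  then show ?thesis by (simp add: padic_null_def)
qed

lemma ideal_padic_null:
  assumes p: "prime p"
  shows "ideal (padic_null p) (padic_Cauchy_ring p)"
proof -
  let ?R = "padic_Cauchy_ring p"
  interpret R: cring ?R by (rule cring_padic_Cauchy_ring[OF p])
  have minus: "\<ominus>\<^bsub>?R\<^esub> s = (\<lambda>n. - s n)" if "padic_Cauchy p s" for s
    by (rule R.minus_equality) (use that in \<open>auto intro: padic_Cauchy_uminus\<close>)
  show ?thesis
  proof (rule idealI)
    show "ring ?R" by (rule R.ring_axioms)
    show "subgroup (padic_null p) (add_monoid ?R)"
    proof (rule R.add.subgroupI)
      show "padic_null p \<subseteq> carrier ?R" using padic_null_imp_Cauchy[OF p] by auto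
      have "(\<lambda>n. 0) \<in> padic_null p" by (simp add: padic_null_def)
      then show "padic_null p \<noteq> {}" by blast
    next
      fix s assume s: "s \<in> padic_null p"
      show "\<ominus>\<^bsub>?R\<^esub> s \<in> padic_null p"
        using s minus[OF padic_null_imp_Cauchy[OF p s]] by (simp add: padic_null_def)
    qed (simp add: padic_null_add[OF p])
  qed (use padic_null_mult[OF p] in \<open>auto simp: mult.commute\<close>)
qed

lemma cring_Qp: "prime p \<Longrightarrow> cring (Qp p)"
  unfolding Qp_def by (intro ideal.quotient_is_cring ideal_padic_null cring_padic_Cauchy_ring)

lemma carrier_Qp:
  "carrier (Qp p) = (\<Union>s\<in>{s. padic_Cauchy p s}. {padic_null p +>\<^bsub>padic_Cauchy_ring p\<^esub> s})"
  by (simp add: Qp_def FactRing_def A_RCOSETS_def')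

lemma padic_class_iff:
  "t \<in> padic_null p +>\<^bsub>padic_Cauchy_ring p\<^esub> s \<longleftrightarrow> (\<lambda>n. t n - s n) \<in> padic_null p"
proof -
  have "t = (\<lambda>n. h n + s n) \<longleftrightarrow> h = (\<lambda>n. t n - s n)" for h
    by (auto simp: fun_eq_iff algebra_simps)
  then show ?thesis by (auto simp: a_r_coset_def')
qed

lemma padic_null_iff: "s \<in> padic_null p \<longleftrightarrow> (\<lambda>n. padic_abs p (s n)) \<longlonglongrightarrow> 0"
  by (simp add: padic_null_def)

lemma padic_class_rep:
  assumes "s \<in> \<alpha>" "\<alpha> \<in> carrier (Qp p)" and p: "prime p"
  shows "padic_Cauchy p s" "\<alpha> = padic_null p +>\<^bsub>padic_Cauchy_ring p\<^esub> s"
proof -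
  interpret I: ideal "padic_null p" "padic_Cauchy_ring p" by (rule ideal_padic_null[OF p])
  obtain t where t: "padic_Cauchy p t" "\<alpha> = padic_null p +>\<^bsub>padic_Cauchy_ring p\<^esub> t"
    using assms by (auto simp: carrier_Qp)
  then have "padic_Cauchy p (\<lambda>n. s n - t n)"
    using assms(1) padic_null_imp_Cauchy[OF p] padic_class_iff by blast
  from padic_Cauchy_add[OF p this t(1)] show "padic_Cauchy p s" by simp
  show "\<alpha> = padic_null p +>\<^bsub>padic_Cauchy_ring p\<^esub> s"
    unfolding t(2) by (rule I.a_repr_independence[OF _ _ I.a_subgroup]) (use assms(1) t in auto)
qed

lemma padic_norm_tendsto:
  assumes p: "prime p" and \<alpha>: "\<alpha> \<in> carrier (Qp p)" and s: "s \<in> \<alpha>"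
  shows "(\<lambda>n. padic_abs p (s n)) \<longlonglongrightarrow> padic_norm p \<alpha>"
proof -
  have "padic_Cauchy p s" by (rule padic_class_rep[OF s \<alpha> p])
  then obtain r where r: "(\<lambda>n. padic_abs p (s n)) \<longlonglongrightarrow> r"
    using padic_Cauchy_abs_convergent[OF p] by (auto simp: convergent_def)
  have all: "(\<lambda>n. padic_abs p (t n)) \<longlonglongrightarrow> r" if "t \<in> \<alpha>" for t
  proof -
    have "(\<lambda>n. padic_abs p (t n - s n)) \<longlonglongrightarrow> 0"
      using that padic_class_rep(2)[OF s \<alpha> p] by (simp add: padic_class_iff padic_null_iff)
    then have "(\<lambda>n. padic_abs p (t n) - padic_abs p (s n)) \<longlonglongrightarrow> 0"
      by (rule Lim_null_comparison[rotated]) (simp add: padic_abs_triangle_diff[OF p])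
    from tendsto_add[OF this r] show ?thesis by simp
  qed
  have "padic_norm p \<alpha> = r"
    unfolding padic_norm_def using all s by (intro the_equality) (auto dest: LIMSEQ_unique)
  then show ?thesis using r by simp
qed

lemma padic_of_rat_norm:
  assumes p: "prime p"
  shows "padic_norm p (padic_of_rat p q) = padic_abs p q"
proof -
  have "padic_of_rat p q \<in> carrier (Qp p)"
    using padic_Cauchy_const[of p q] unfolding carrier_Qp padic_of_rat_def by blast
  moreover have "(\<lambda>n. q) \<in> padic_of_rat p q"
    by (simp add: padic_of_rat_def padic_class_iff padic_null_iff)
  ultimately have "(\<lambda>n. padic_abs p q) \<longlonglongrightarrow> padic_norm p (padic_of_rat p q)"
    by (rule padic_norm_tendsto[OF p])
  then show ?thesis by (simp add: LIMSEQ_const_iff)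
qed

lemma field_Qp:
  assumes p: "prime p"
  shows "field (Qp p)"
proof -
  let ?R = "padic_Cauchy_ring p" and ?I = "padic_null p"
  interpret I: ideal ?I ?R by (rule ideal_padic_null[OF p])
  interpret Q: cring "Qp p" by (rule cring_Qp[OF p])
  have mult: "(?I +>\<^bsub>?R\<^esub> s) \<otimes>\<^bsub>Qp p\<^esub> (?I +>\<^bsub>?R\<^esub> t) = ?I +>\<^bsub>?R\<^esub> (\<lambda>n. s n * t n)"
    if "padic_Cauchy p s" "padic_Cauchy p t" for s t
    using I.rcoset_mult_add[of s t] that by (simp add: Qp_def FactRing_def)
  have one: "\<one>\<^bsub>Qp p\<^esub> = ?I +>\<^bsub>?R\<^esub> (\<lambda>n. 1)" by (simp add: Qp_def FactRing_def)
  have zero: "\<zero>\<^bsub>Qp p\<^esub> = ?I" by (simp add: Qp_def FactRing_def)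
  have class_eq: "?I +>\<^bsub>?R\<^esub> t = ?I +>\<^bsub>?R\<^esub> s"
    if "padic_Cauchy p s" "(\<lambda>n. t n - s n) \<in> ?I" for s t
  proof -
    have "t \<in> ?I +>\<^bsub>?R\<^esub> s" using that(2) by (simp add: padic_class_iff)
    moreover have "?I +>\<^bsub>?R\<^esub> s \<in> carrier (Qp p)" using that(1) by (auto simp: carrier_Qp)
    ultimately show ?thesis using padic_class_rep(2)[OF _ _ p] by blast
  qed
  show ?thesis
  proof (rule Q.cring_fieldI2)
    have "(\<lambda>n. 1) \<in> ?I +>\<^bsub>?R\<^esub> (\<lambda>n. 1)" "(\<lambda>n. 1) \<notin> ?I"
      by (auto simp: padic_class_iff padic_null_iff LIMSEQ_const_iff)
    then show "\<zero>\<^bsub>Qp p\<^esub> \<noteq> \<one>\<^bsub>Qp p\<^esub>" unfolding zero one by blast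
  next
    fix \<alpha> assume \<alpha>: "\<alpha> \<in> carrier (Qp p)" "\<alpha> \<noteq> \<zero>\<^bsub>Qp p\<^esub>"
    then obtain s where s: "padic_Cauchy p s" "\<alpha> = ?I +>\<^bsub>?R\<^esub> s" by (auto simp: carrier_Qp)
    obtain l where l: "(\<lambda>n. padic_abs p (s n)) \<longlonglongrightarrow> l"
      using padic_Cauchy_abs_convergent[OF p s(1)] by (auto simp: convergent_def)
    have "l \<noteq> 0"
    proof
      assume "l = 0"
      then have "s \<in> ?I" using l by (simp add: padic_null_def)
      then have "\<alpha> = ?I" using s(2) I.a_rcos_const by simp
      then show False using \<alpha>(2) zero by simp
    qed
    moreover have "l \<ge> 0" by (rule LIMSEQ_le_const[OF l]) simp
    ultimately have "l > 0" by simp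
    then have "\<forall>\<^sub>F n in sequentially. padic_abs p (s n) > l / 2"
      by (intro order_tendstoD(1)[OF l]) simp
    then obtain K where K: "\<And>n. n \<ge> K \<Longrightarrow> padic_abs p (s n) > l / 2"
      by (auto simp: eventually_sequentially)
    have nz: "s n \<noteq> 0" if "n \<ge> K" for n using K[OF that] \<open>l > 0\<close> by auto
    have t: "padic_Cauchy p (\<lambda>n. inverse (s n))"
      unfolding padic_Cauchy_def
    proof (intro allI impI)
      fix e :: real assume "e > 0"
      then have "e * (l / 2)\<^sup>2 > 0" using \<open>l > 0\<close> by simp
      then obtain M where M: "\<forall>m\<ge>M. \<forall>n\<ge>M. padic_abs p (s m - s n) < e * (l / 2)\<^sup>2"
        using s(1) unfolding padic_Cauchy_def by metis
      have "padic_abs p (inverse (s m) - inverse (s n)) < e"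
        if "m \<ge> max M K" "n \<ge> max M K" for m n
      proof -
        have "inverse (s m) - inverse (s n) = (s n - s m) * (inverse (s m) * inverse (s n))"
          using nz[of m] nz[of n] that by (simp add: field_simps)
        then have eq: "padic_abs p (inverse (s m) - inverse (s n)) =
            padic_abs p (s n - s m) * inverse (padic_abs p (s m) * padic_abs p (s n))"
          by (simp add: padic_abs_mult[OF p] padic_abs_inverse[OF p])
        have gt: "(l / 2)\<^sup>2 \<le> padic_abs p (s m) * padic_abs p (s n)"
          unfolding power2_eq_square using K[of m] K[of n] that \<open>l > 0\<close>
          by (intro mult_mono) auto
        have pos: "(l / 2)\<^sup>2 > 0" using \<open>l > 0\<close> by simp
        have "padic_abs p (s n - s m) < e * (l / 2)\<^sup>2" using M that by simp
        also have "\<dots> \<le> e * (padic_abs p (s m) * padic_abs p (s n))"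
          using gt \<open>e > 0\<close> by (intro mult_left_mono) auto
        finally have "padic_abs p (s n - s m) < e * (padic_abs p (s m) * padic_abs p (s n))" .
        moreover have "padic_abs p (s m) * padic_abs p (s n) > 0" using gt pos by linarith
        ultimately show ?thesis
          unfolding eq divide_inverse[symmetric] by (simp only: pos_divide_less_eq)
      qed
      then show "\<exists>N. \<forall>m\<ge>N. \<forall>n\<ge>N. padic_abs p (inverse (s m) - inverse (s n)) < e" by blast
    qed
    have "\<forall>\<^sub>F n in sequentially. padic_abs p (s n * inverse (s n) - 1) = 0"
      using nz by (auto simp: eventually_sequentially intro!: exI[of _ K])
    then have "(\<lambda>n. s n * inverse (s n) - 1) \<in> ?I"
      unfolding padic_null_def by (auto intro: tendsto_eventually)
    then have "?I +>\<^bsub>?R\<^esub> (\<lambda>n. s n * inverse (s n)) = ?I +>\<^bsub>?R\<^esub> (\<lambda>n. 1)"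
      by (intro class_eq) auto
    then have "\<alpha> \<otimes>\<^bsub>Qp p\<^esub> (?I +>\<^bsub>?R\<^esub> (\<lambda>n. inverse (s n))) = \<one>\<^bsub>Qp p\<^esub>"
      using mult[OF s(1) t] s(2) one by simp
    then show "\<exists>\<beta>\<in>carrier (Qp p). \<alpha> \<otimes>\<^bsub>Qp p\<^esub> \<beta> = \<one>\<^bsub>Qp p\<^esub>"
      using t by (intro bexI[of _ "?I +>\<^bsub>?R\<^esub> (\<lambda>n. inverse (s n))"]) (auto simp: carrier_Qp)
  qed
qed

definition padic_irrational :: "nat \<Rightarrow> (nat \<Rightarrow> rat) set \<Rightarrow> bool" where
  "padic_irrational p \<xi> \<longleftrightarrow> \<xi> \<in> carrier (Qp p) \<and> \<xi> \<notin> range (padic_of_rat p)"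


section \<open>The multiplicative exponents of approximation\<close>

text \<open>This is $|y\xi - x|_p$; note the order of the arguments \<open>x\<close>, \<open>y\<close>.\<close>

definition padic_lin :: "nat \<Rightarrow> (nat \<Rightarrow> rat) set \<Rightarrow> int \<Rightarrow> int \<Rightarrow> real" where
  "padic_lin p \<xi> x y = padic_norm p
     (padic_of_rat p (of_int y) \<otimes>\<^bsub>Qp p\<^esub> \<xi> \<ominus>\<^bsub>Qp p\<^esub> padic_of_rat p (of_int x))"

lemma padic_lin_tendsto:
  assumes p: "prime p" and \<xi>: "\<xi> \<in> carrier (Qp p)" and s: "s \<in> \<xi>"
  shows "(\<lambda>n. padic_abs p (of_int y * s n - of_int x)) \<longlonglongrightarrow> padic_lin p \<xi> x y"
proof -
  let ?R = "padic_Cauchy_ring p" and ?I = "padic_null p"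
  interpret I: ideal ?I ?R by (rule ideal_padic_null[OF p])
  interpret Q: cring "Qp p" by (rule cring_Qp[OF p])
  have S: "padic_Cauchy p s" "\<xi> = ?I +>\<^bsub>?R\<^esub> s" by (rule padic_class_rep[OF s \<xi> p])+
  have mult: "(?I +>\<^bsub>?R\<^esub> u) \<otimes>\<^bsub>Qp p\<^esub> (?I +>\<^bsub>?R\<^esub> v) = ?I +>\<^bsub>?R\<^esub> (\<lambda>n. u n * v n)"
    and add: "(?I +>\<^bsub>?R\<^esub> u) \<oplus>\<^bsub>Qp p\<^esub> (?I +>\<^bsub>?R\<^esub> v) = ?I +>\<^bsub>?R\<^esub> (\<lambda>n. u n + v n)"
    if "padic_Cauchy p u" "padic_Cauchy p v" for u v
    using I.rcoset_mult_add[of u v] I.a_rcos_sum[of u v] that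
    by (simp_all add: Qp_def FactRing_def)
  have carr: "?I +>\<^bsub>?R\<^esub> u \<in> carrier (Qp p)" if "padic_Cauchy p u" for u
    using that by (auto simp: carrier_Qp)
  have zero: "\<zero>\<^bsub>Qp p\<^esub> = ?I +>\<^bsub>?R\<^esub> (\<lambda>n. 0)"
    using I.a_rcos_const[of "\<lambda>n. 0"] by (simp add: Qp_def FactRing_def padic_null_iff)
  have "\<ominus>\<^bsub>Qp p\<^esub> padic_of_rat p (of_int x) = ?I +>\<^bsub>?R\<^esub> (\<lambda>n. - of_int x)"
    by (rule Q.minus_equality) (simp_all add: padic_of_rat_def add carr zero)
  then have eq: "padic_of_rat p (of_int y) \<otimes>\<^bsub>Qp p\<^esub> \<xi> \<ominus>\<^bsub>Qp p\<^esub> padic_of_rat p (of_int x)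
      = ?I +>\<^bsub>?R\<^esub> (\<lambda>n. of_int y * s n - of_int x)" (is "?lhs = _")
    using S by (simp add: a_minus_def padic_of_rat_def mult add padic_Cauchy_mult[OF p])
  have "padic_Cauchy p (\<lambda>n. of_int y * s n - of_int x)"
    using padic_Cauchy_add[OF p padic_Cauchy_mult[OF p padic_Cauchy_const S(1)] padic_Cauchy_const,
        of "of_int y" "- of_int x"] by simp
  then have "?lhs \<in> carrier (Qp p)" unfolding eq by (rule carr)
  moreover have "(\<lambda>n. of_int y * s n - of_int x) \<in> ?lhs"
    unfolding eq by (simp add: padic_class_iff padic_null_iff)
  ultimately show ?thesis unfolding padic_lin_def by (rule padic_norm_tendsto[OF p])
qed

text \<open>The suprema are taken in the extended reals, so that the exponents may be infinite.
  With the \<open>ereal\<close> conventions $2 / 0 = \infty$ and $2 / \infty = 0$, the bound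
  $3 + 2 / (\mu - 2)$ is $\infty$ for $\mu = 2$ and $3$ for $\mu = \infty$.\<close>

definition mu_times :: "nat \<Rightarrow> (nat \<Rightarrow> rat) set \<Rightarrow> ereal" where
  "mu_times p \<xi> = Sup (ereal ` {m. infinite {(x::int, y::int). x \<noteq> 0 \<and> y \<noteq> 0 \<and>
     0 < padic_lin p \<xi> x y \<and> padic_lin p \<xi> x y \<le> sqrt \<bar>real_of_int (x * y)\<bar> powr (- m)}})"

definition mu_hat_times :: "nat \<Rightarrow> (nat \<Rightarrow> rat) set \<Rightarrow> ereal" where
  "mu_hat_times p \<xi> = Sup (ereal ` {m. \<forall>\<^sub>F X::real in at_top. \<exists>x y::int.
     0 < sqrt \<bar>real_of_int (x * y)\<bar> \<and> sqrt \<bar>real_of_int (x * y)\<bar> \<le> X \<and>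
     padic_lin p \<xi> x y \<le> X powr (- m)})"

end

theory Submission
  imports Defs
begin

text \<open>For a primitive point \<open>P = (x, y)\<close> write \<open>H = \<bar>xy\<bar>\<^sup>1\<^sup>/\<^sup>2\<close> and \<open>L = \<bar>y\<xi> - x\<bar>\<^sub>p\<close>. A multiple of \<open>P\<close> can
  solve the uniform system at \<open>X\<close> with exponent \<open>w\<close> only if \<open>L H \<le> X\<^sup>1\<^sup>-\<^sup>w\<close>, so just beyond the \<open>X\<close> with
  equality there is a solution \<open>P'\<close> independent of \<open>P\<close>, and the determinant \<open>D\<close> of \<open>P, P'\<close>
  satisfies \<open>1 \<le> \<bar>D\<bar> \<bar>D\<bar>\<^sub>p \<le> 2 H\<^sup>2 H'\<^sup>2 max L L'\<close>. If \<open>P\<close> is a very good approximation, this is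
  the first inequality.

  For the second one, two such steps give pairwise independent points \<open>P\<^sub>1, P\<^sub>2, P\<^sub>3\<close>. With the slope
  \<open>s = (ln \<bar>y\<bar> - ln \<bar>x\<bar>) / 2\<close>, which lies in \<open>[- ln H, ln H]\<close>, one has
  \<open>\<bar>D\<bar> \<le> 2 H H' exp \<bar>s - s'\<bar>\<close>, so the three slopes are pairwise far apart. When \<open>w > 3\<close> there is no
  room for this unless \<open>H\<^sub>3\<close> is at least about \<open>X\<^sub>2\<close> to the power \<open>w - 2\<close>, where \<open>X\<^sub>2\<close> is the parameter at
  which \<open>P\<^sub>2\<close> was found; hence multiples of \<open>P\<^sub>2\<close> suffice nearly up to that height, which makes
  \<open>L\<^sub>2\<close> small. Eliminating \<open>\<mu>\<close> from the two inequalities gives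
  \<open>(w - 1) (w\<^sup>2 - 5w + 5) \<le> 0\<close>, the third.\<close>

section \<open>The $p$-adic absolute value on the integers\<close>

lemma padic_abs_of_int:
  assumes "prime p" "k \<noteq> 0"
  shows "padic_abs p (of_int k) = 1 / real p ^ multiplicity (int p) k"
proof -
  have "padic_val p (of_int k / of_int 1) = int (multiplicity (int p) k)"
    using assms by (subst padic_val_of_int_divide) auto
  then show ?thesis
    using assms by (simp add: padic_abs_def power_int_minus divide_inverse)
qed

lemma padic_abs_of_int_le_1:
  assumes "prime p"
  shows "padic_abs p (of_int k) \<le> 1"
proof (cases "k = 0")
  case False
  have "1 \<le> real p ^ multiplicity (int p) k"
    using prime_gt_0_nat[OF assms] by (intro one_le_power) simp
  then show ?thesis
    unfolding padic_abs_of_int[OF assms False] by (subst divide_le_eq_1_pos) linarith+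
qed simp

lemma padic_abs_of_int_ge:
  assumes "prime p" "k \<noteq> 0"
  shows "1 / real_of_int \<bar>k\<bar> \<le> padic_abs p (of_int k)"
proof -
  have "int p ^ multiplicity (int p) k \<le> \<bar>k\<bar>"
    using dvd_imp_le_int[OF assms(2) multiplicity_dvd[of "int p" k]] by simp
  then have "real_of_int (int p ^ multiplicity (int p) k) \<le> real_of_int \<bar>k\<bar>"
    by (simp only: of_int_le_iff)
  moreover have "real p ^ multiplicity (int p) k > 0"
    using prime_gt_0_nat[OF assms(1)] by simp
  ultimately show ?thesis
    unfolding padic_abs_of_int[OF assms] using assms(2) by (intro divide_left_mono) auto
qed

lemma padic_abs_of_int_power_dvd:
  assumes "prime p" "int p ^ n dvd k"
  shows "padic_abs p (of_int k) \<le> 1 / real p ^ n"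
proof (cases "k = 0")
  case False
  have "\<not> is_unit (int p)" using assms(1) not_prime_unit by auto
  then have "n \<le> multiplicity (int p) k"
    using False assms(2) by (intro multiplicity_geI) auto
  then have "real p ^ n \<le> real p ^ multiplicity (int p) k"
    using prime_gt_0_nat[OF assms(1)] by (intro power_increasing) auto
  then show ?thesis
    unfolding padic_abs_of_int[OF assms(1) False]
    using prime_gt_0_nat[OF assms(1)] by (intro divide_left_mono) auto
qed simp


section \<open>The linear form and the height on a logarithmic scale\<close>

definition log_height :: "int \<Rightarrow> int \<Rightarrow> real" where
  "log_height x y = (ln \<bar>real_of_int x\<bar> + ln \<bar>real_of_int y\<bar>) / 2"

definition log_slope :: "int \<Rightarrow> int \<Rightarrow> real" where
  "log_slope x y = (ln \<bar>real_of_int y\<bar> - ln \<bar>real_of_int x\<bar>) / 2"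

lemma sqrt_eq_exp_log_height:
  assumes "x \<noteq> 0" "y \<noteq> 0"
  shows "sqrt \<bar>real_of_int (x * y)\<bar> = exp (log_height x y)"
proof -
  have "exp (log_height x y) ^ 2 = exp (ln \<bar>real_of_int x\<bar>) * exp (ln \<bar>real_of_int y\<bar>)"
    unfolding log_height_def by (simp add: power2_eq_square flip: exp_add)
  then have "exp (log_height x y) ^ 2 = \<bar>real_of_int (x * y)\<bar>"
    using assms by (simp add: abs_mult)
  then show ?thesis by (intro real_sqrt_unique) auto
qed

text \<open>The case x = 0 is covered by the default value \<open>ln 0 = 0\<close>.\<close>

lemma ln_abs_int_nonneg: "0 \<le> ln \<bar>real_of_int x\<bar>"
proof (cases "x = 0")
  case False
  then have "1 \<le> \<bar>real_of_int x\<bar>" by linarith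
  then show ?thesis by simp
qed simp

lemma log_height_nonneg: "0 \<le> log_height x y"
  using ln_abs_int_nonneg[of x] ln_abs_int_nonneg[of y] by (simp add: log_height_def)

lemma abs_log_slope_le: "\<bar>log_slope x y\<bar> \<le> log_height x y"
  using ln_abs_int_nonneg[of x] ln_abs_int_nonneg[of y]
  by (auto simp: log_slope_def log_height_def)

lemma log_height_scale:
  assumes "k \<noteq> 0" "x \<noteq> 0" "y \<noteq> 0"
  shows "log_height (k * x) (k * y) = ln \<bar>real_of_int k\<bar> + log_height x y"
  using assms by (simp add: log_height_def abs_mult ln_mult field_simps)

text \<open>Northcott property: both logarithms are nonnegative, so a bound on their sum bounds each
  coordinate by exp (2 B).\<close>

lemma finite_log_height_le: "finite {(x, y). x \<noteq> 0 \<and> y \<noteq> 0 \<and> log_height x y \<le> B}"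
proof -
  let ?N = "\<lceil>exp (2 * B)\<rceil>"
  have le: "\<bar>x\<bar> \<le> ?N" if "x \<noteq> 0" "ln \<bar>real_of_int x\<bar> \<le> 2 * B" for x
  proof -
    have "exp (ln \<bar>real_of_int x\<bar>) \<le> exp (2 * B)" using that(2) by simp
    then have "\<bar>real_of_int x\<bar> \<le> exp (2 * B)" using that(1) by simp
    also have "\<dots> \<le> ?N" by simp
    finally show ?thesis by (simp flip: of_int_abs)
  qed
  have "(x, y) \<in> {- ?N..?N} \<times> {- ?N..?N}" if "x \<noteq> 0" "y \<noteq> 0" "log_height x y \<le> B" for x y
    using that le[of x] le[of y] ln_abs_int_nonneg[of x] ln_abs_int_nonneg[of y]
    by (auto simp: log_height_def)
  then have "{(x, y). x \<noteq> 0 \<and> y \<noteq> 0 \<and> log_height x y \<le> B} \<subseteq> {- ?N..?N} \<times> {- ?N..?N}"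
    by blast
  then show ?thesis by (rule finite_subset) simp
qed

lemma gcd_decompose:
  fixes x y :: int
  assumes "x \<noteq> 0" "y \<noteq> 0"
  obtains k a b where "k \<noteq> 0" "a \<noteq> 0" "b \<noteq> 0" "coprime a b" "x = k * a" "y = k * b"
proof -
  have "gcd x y \<noteq> 0" using assms by simp
  then obtain a b where "x = a * gcd x y" "y = b * gcd x y" "coprime a b"
    using gcd_coprime_exists by blast
  moreover have "a \<noteq> 0" "b \<noteq> 0" using calculation assms by (metis mult_zero_left)+
  ultimately show ?thesis
    using that[of "gcd x y" a b] \<open>gcd x y \<noteq> 0\<close> by (metis mult.commute)
qed

section \<open>The linear form of a fixed irrational \<xi>\<close>

locale irrational_padic =
  fixes p :: nat and \<xi> :: "(nat \<Rightarrow> rat) set"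
  assumes prime: "prime p" and irrational: "padic_irrational p \<xi>"
begin

lemma \<xi>_carrier: "\<xi> \<in> carrier (Qp p)"
  using irrational by (simp add: padic_irrational_def)

lemma \<xi>_representative: obtains s where "s \<in> \<xi>" "padic_Cauchy p s"
proof -
  obtain s where s: "padic_Cauchy p s" "\<xi> = padic_null p +>\<^bsub>padic_Cauchy_ring p\<^esub> s"
    using \<xi>_carrier by (auto simp: carrier_Qp)
  have "s \<in> \<xi>" unfolding s(2) by (simp add: padic_class_iff padic_null_iff)
  with s(1) show ?thesis using that by blast
qed

lemma padic_lin_scale: "padic_lin p \<xi> (k * x) (k * y) = padic_abs p (of_int k) * padic_lin p \<xi> x y"
proof -
  obtain s where s: "s \<in> \<xi>" by (rule \<xi>_representative)
  note lim = padic_lin_tendsto[OF prime \<xi>_carrier s]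
  have "(\<lambda>n. padic_abs p (of_int k) * padic_abs p (of_int y * s n - of_int x))
      \<longlonglongrightarrow> padic_abs p (of_int k) * padic_lin p \<xi> x y"
    by (intro tendsto_mult tendsto_const lim)
  moreover have "padic_abs p (of_int k) * padic_abs p (of_int y * s n - of_int x) =
      padic_abs p (of_int (k * y) * s n - of_int (k * x))" for n
    by (simp add: algebra_simps flip: padic_abs_mult[OF prime])
  ultimately show ?thesis using lim[of "k * y" "k * x"] LIMSEQ_unique by simp
qed

lemma padic_lin_0_right: "padic_lin p \<xi> x 0 = padic_abs p (of_int x)"
proof -
  obtain s where s: "s \<in> \<xi>" by (rule \<xi>_representative)
  show ?thesis
    using padic_lin_tendsto[OF prime \<xi>_carrier s, of 0 x] by (simp add: LIMSEQ_const_iff)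
qed

lemma padic_lin_nonneg: "0 \<le> padic_lin p \<xi> x y"
proof -
  obtain s where s: "s \<in> \<xi>" by (rule \<xi>_representative)
  show ?thesis by (rule LIMSEQ_le_const[OF padic_lin_tendsto[OF prime \<xi>_carrier s]]) simp
qed

text \<open>The one place where \<xi> not being rational matters: a vanishing form with y nonzero
  would put the constant sequence x / y into the class \<xi>.\<close>

lemma padic_lin_pos:
  assumes "x \<noteq> 0 \<or> y \<noteq> 0"
  shows "0 < padic_lin p \<xi> x y"
proof (cases "y = 0")
  case True
  then show ?thesis
    using assms padic_abs_eq_0_iff[OF prime, of "of_int x"] padic_abs_nonneg[of p "of_int x"]
    by (simp add: padic_lin_0_right less_le)
next
  case False
  obtain s where s: "s \<in> \<xi>" by (rule \<xi>_representative)
  have "padic_lin p \<xi> x y \<noteq> 0"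
  proof
    assume "padic_lin p \<xi> x y = 0"
    then have "(\<lambda>n. padic_abs p (inverse (of_int y)) * padic_abs p (of_int y * s n - of_int x))
        \<longlonglongrightarrow> padic_abs p (inverse (of_int y)) * 0"
      using padic_lin_tendsto[OF prime \<xi>_carrier s, of y x] by (intro tendsto_mult) auto
    moreover have "padic_abs p (inverse (of_int y)) * padic_abs p (of_int y * s n - of_int x) =
        padic_abs p (of_int x / of_int y - s n)" for n
      unfolding padic_abs_minus_commute[of p _ "s n"]
      using False by (simp add: field_simps flip: padic_abs_mult[OF prime])
    ultimately have "(\<lambda>n. of_int x / of_int y) \<in> \<xi>"
      using padic_class_rep(2)[OF s \<xi>_carrier prime] by (simp add: padic_class_iff padic_null_iff)
    then have "\<xi> = padic_of_rat p (of_int x / of_int y)"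
      using padic_class_rep(2)[OF _ \<xi>_carrier prime] by (simp add: padic_of_rat_def)
    then show False using irrational by (simp add: padic_irrational_def)
  qed
  then show ?thesis using padic_lin_nonneg[of x y] by simp
qed

text \<open>The determinant equals y (y' \<xi> - x') - y' (y \<xi> - x), and integers have p-adic
  absolute value at most 1.\<close>

lemma padic_abs_det_le:
  "padic_abs p (of_int (x * y' - x' * y)) \<le> max (padic_lin p \<xi> x y) (padic_lin p \<xi> x' y')"
proof -
  obtain s where s: "s \<in> \<xi>" by (rule \<xi>_representative)
  note lim = padic_lin_tendsto[OF prime \<xi>_carrier s]
  have "padic_abs p (of_int (x * y' - x' * y)) \<le>
      max (padic_abs p (of_int y * s n - of_int x)) (padic_abs p (of_int y' * s n - of_int x'))" for n
  proof -
    let ?u = "of_int y * s n - of_int x" and ?v = "of_int y' * s n - of_int x'"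
    have le: "padic_abs p (of_int k * u) \<le> padic_abs p u" for k u
      using mult_right_mono[OF padic_abs_of_int_le_1[OF prime, of k] padic_abs_nonneg[of p u]]
      by (simp add: padic_abs_mult[OF prime])
    have eq: "of_int (x * y' - x' * y) = of_int y * ?v - of_int y' * ?u"
      by (simp add: algebra_simps)
    show ?thesis unfolding eq
      using padic_abs_diff[OF prime, of "of_int y * ?v" "of_int y' * ?u"] le[of y ?v] le[of y' ?u]
      by linarith
  qed
  then show ?thesis by (intro LIMSEQ_le_const[OF tendsto_max[OF lim lim]]) auto
qed

definition log_lin :: "int \<Rightarrow> int \<Rightarrow> real" where
  "log_lin x y = ln (padic_lin p \<xi> x y)"

lemma padic_lin_eq_exp:
  assumes "x \<noteq> 0 \<or> y \<noteq> 0"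
  shows "padic_lin p \<xi> x y = exp (log_lin x y)"
  using padic_lin_pos[OF assms] by (simp add: log_lin_def)

text \<open>Since |k|_p >= 1 / |k|, dividing a point by k enlarges the form by a factor of at most
  |k|. The height shrinks by exactly |k|, so \<open>log_lin + log_height\<close> never
  increases.\<close>

lemma log_lin_le_scale:
  assumes "k \<noteq> 0" "x \<noteq> 0 \<or> y \<noteq> 0"
  shows "log_lin x y \<le> ln \<bar>real_of_int k\<bar> + log_lin (k * x) (k * y)"
proof -
  have "1 / real_of_int \<bar>k\<bar> * padic_lin p \<xi> x y \<le> padic_lin p \<xi> (k * x) (k * y)"
    unfolding padic_lin_scale
    by (intro mult_right_mono padic_abs_of_int_ge prime assms padic_lin_nonneg)
  then have "padic_lin p \<xi> x y \<le> \<bar>real_of_int k\<bar> * padic_lin p \<xi> (k * x) (k * y)"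
    using assms(1) by (simp add: field_simps)
  then have "ln (padic_lin p \<xi> x y) \<le> ln (\<bar>real_of_int k\<bar> * padic_lin p \<xi> (k * x) (k * y))"
    using padic_lin_pos[OF assms(2)] by simp
  also have "\<dots> = ln \<bar>real_of_int k\<bar> + log_lin (k * x) (k * y)"
    using assms padic_lin_pos[of "k * x" "k * y"] by (simp add: log_lin_def ln_mult)
  finally show ?thesis by (simp add: log_lin_def)
qed

lemma log_lin_uminus: "log_lin (- x) (- y) = log_lin x y"
  using padic_lin_scale[of "- 1" x y] by (simp add: log_lin_def)

text \<open>The product formula \<open>|D| |D|\<^sub>p \<ge> 1\<close> for the determinant \<open>D = x y' - x' y\<close>.\<close>

lemma log_det:
  assumes nz: "x \<noteq> 0" "y \<noteq> 0" "x' \<noteq> 0" "y' \<noteq> 0" and det: "x * y' \<noteq> x' * y"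
  shows "0 \<le> ln 2 + (log_height x y + log_height x' y' + \<bar>log_slope x y - log_slope x' y'\<bar>)
    + max (log_lin x y) (log_lin x' y')" (is "0 \<le> ln 2 + ?A + ?B")
proof -
  let ?D = "x * y' - x' * y"
  \<comment> \<open>Here ln |x| = h - s and ln |y| = h + s for height h and slope s, so the two
    terms of the determinant have logarithms h + h' - (s - s') and h + h' + (s - s').\<close>
  have A: "ln \<bar>real_of_int x\<bar> + ln \<bar>real_of_int y'\<bar> \<le> ?A"
    "ln \<bar>real_of_int x'\<bar> + ln \<bar>real_of_int y\<bar> \<le> ?A"
    by (simp_all add: log_height_def log_slope_def abs_if field_simps)
  have "\<bar>real_of_int x * y'\<bar> = exp (ln \<bar>real_of_int x\<bar> + ln \<bar>real_of_int y'\<bar>)"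
    "\<bar>real_of_int x' * y\<bar> = exp (ln \<bar>real_of_int x'\<bar> + ln \<bar>real_of_int y\<bar>)"
    using nz by (simp_all add: exp_add abs_mult)
  then have "\<bar>real_of_int x * y'\<bar> \<le> exp ?A" "\<bar>real_of_int x' * y\<bar> \<le> exp ?A"
    using A by simp_all
  then have D: "\<bar>real_of_int ?D\<bar> \<le> 2 * exp ?A"
    unfolding of_int_diff of_int_mult by linarith
  have "max (padic_lin p \<xi> x y) (padic_lin p \<xi> x' y') \<le> exp ?B"
    using nz by (simp add: padic_lin_eq_exp)
  moreover have "1 / real_of_int \<bar>?D\<bar> \<le> padic_abs p (of_int ?D)"
    by (rule padic_abs_of_int_ge[OF prime]) (use det in simp)
  ultimately have "1 / real_of_int \<bar>?D\<bar> \<le> exp ?B"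
    using padic_abs_det_le[of x y' x' y] by linarith
  moreover have "?D \<noteq> 0" using det by simp
  then have "0 < real_of_int \<bar>?D\<bar>" by (simp only: of_int_0_less_iff zero_less_abs_iff simp_thms)
  ultimately have "1 \<le> exp ?B * real_of_int \<bar>?D\<bar>" by (simp only: pos_divide_le_eq)
  then have "1 \<le> \<bar>real_of_int ?D\<bar> * exp ?B" by (simp only: of_int_abs mult.commute)
  also have "\<dots> \<le> 2 * exp ?A * exp ?B" using D by (intro mult_right_mono) auto
  also have "\<dots> = exp (ln 2 + ?A + ?B)" by (simp add: exp_add)
  finally show ?thesis by simp
qed

text \<open>Proportional primitive points agree up to sign. Used contrapositively: points that
  differ in \<open>log_lin + log_height\<close> have nonzero determinant.\<close>

lemma coprime_dependent:
  assumes "coprime x y" "coprime x' y'" "x \<noteq> 0" "y \<noteq> 0" "x * y' = x' * y"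
  shows "log_lin x y = log_lin x' y'" "log_height x y = log_height x' y'"
proof -
  have "\<bar>x\<bar> * \<bar>y'\<bar> = \<bar>x'\<bar> * \<bar>y\<bar>" using assms(5) by (simp flip: abs_mult)
  then have eq: "\<bar>x\<bar> = \<bar>x'\<bar>" "\<bar>y\<bar> = \<bar>y'\<bar>"
    using coprime_crossproduct_int[of x y x' y'] assms(1,2) by (simp_all add: coprime_commute)
  then show "log_height x y = log_height x' y'"
    by (simp add: log_height_def flip: of_int_abs)
  have "(x' = x \<and> y' = y) \<or> (x' = - x \<and> y' = - y)"
    using eq assms(3-5) by (auto simp: abs_if split: if_splits)
  then show "log_lin x y = log_lin x' y'" by (auto simp: log_lin_uminus)
qed

end


section \<open>The two exponent inequalities\<close>

text \<open>The three slopes are so far apart that the outermost two can only be the second and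
  the third one, which forces the third height to be large.\<close>

lemma three_points_arith:
  fixes h\<^sub>1 h\<^sub>2 h\<^sub>3 s\<^sub>1 s\<^sub>2 s\<^sub>3 l\<^sub>1 l\<^sub>2 l\<^sub>3 t\<^sub>2 t\<^sub>3 c d :: real
  assumes s: "\<bar>s\<^sub>1\<bar> \<le> h\<^sub>1" "\<bar>s\<^sub>2\<bar> \<le> h\<^sub>2" "\<bar>s\<^sub>3\<bar> \<le> h\<^sub>3"
    and h: "h\<^sub>1 \<le> t\<^sub>2" "h\<^sub>2 \<le> t\<^sub>2" "h\<^sub>3 \<le> t\<^sub>3" "t\<^sub>2 \<le> t\<^sub>3"
    and l: "l\<^sub>1 + h\<^sub>1 = c - (d + 2) * t\<^sub>2" "l\<^sub>2 + h\<^sub>2 = c - (d + 2) * t\<^sub>3"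
      "l\<^sub>2 + h\<^sub>2 \<le> - ((d + 2) * t\<^sub>2)" "l\<^sub>3 + h\<^sub>3 \<le> - ((d + 2) * t\<^sub>3)"
    and det: "0 \<le> c + (h\<^sub>1 + h\<^sub>2 + \<bar>s\<^sub>1 - s\<^sub>2\<bar>) + max l\<^sub>1 l\<^sub>2"
      "0 \<le> c + (h\<^sub>1 + h\<^sub>3 + \<bar>s\<^sub>1 - s\<^sub>3\<bar>) + max l\<^sub>1 l\<^sub>3"
      "0 \<le> c + (h\<^sub>2 + h\<^sub>3 + \<bar>s\<^sub>2 - s\<^sub>3\<bar>) + max l\<^sub>2 l\<^sub>3"
    and large: "0 \<le> c" "0 \<le> d" "4 * c < d * t\<^sub>2"
  shows "(d + 1) * t\<^sub>2 \<le> h\<^sub>3 + 2 * c"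
proof -
  \<comment> \<open>The application has c = ln 2 and d = w - 3. With the products named, all
    constraints become linear.\<close>
  define P Q where "P = d * t\<^sub>2" and "Q = d * t\<^sub>3"
  have "P \<le> Q" using h(4) large(2) by (simp add: P_def Q_def mult_left_mono)
  have eqs: "(d + 2) * t\<^sub>2 = P + 2 * t\<^sub>2" "(d + 2) * t\<^sub>3 = Q + 2 * t\<^sub>3"
    "(d + 1) * t\<^sub>2 = P + t\<^sub>2" "d * t\<^sub>2 = P"
    by (simp_all add: P_def Q_def algebra_simps)
  note l' = l[unfolded eqs] and large' = large(1,3)[unfolded eqs]
  \<comment> \<open>Each determinant bound splits according to which of the two forms attains the
    maximum.\<close>
  have 12: "P + 2 * t\<^sub>2 - h\<^sub>2 - 2 * c \<le> \<bar>s\<^sub>1 - s\<^sub>2\<bar> \<or> P + 2 * t\<^sub>2 - h\<^sub>1 - c \<le> \<bar>s\<^sub>1 - s\<^sub>2\<bar>"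
    using det(1) l'(1,3) by linarith
  have 13: "P + 2 * t\<^sub>2 - h\<^sub>3 - 2 * c \<le> \<bar>s\<^sub>1 - s\<^sub>3\<bar> \<or> Q + 2 * t\<^sub>3 - h\<^sub>1 - c \<le> \<bar>s\<^sub>1 - s\<^sub>3\<bar>"
    using det(2) l'(1,4) by linarith
  have 23: "Q + 2 * t\<^sub>3 - h\<^sub>3 - 2 * c \<le> \<bar>s\<^sub>2 - s\<^sub>3\<bar> \<or> Q + 2 * t\<^sub>3 - h\<^sub>2 - c \<le> \<bar>s\<^sub>2 - s\<^sub>3\<bar>"
    using det(3) l'(2,4) by linarith
  have le: "\<bar>s\<^sub>1 - s\<^sub>2\<bar> \<le> h\<^sub>1 + h\<^sub>2" "\<bar>s\<^sub>1 - s\<^sub>3\<bar> \<le> h\<^sub>1 + h\<^sub>3" "\<bar>s\<^sub>2 - s\<^sub>3\<bar> \<le> h\<^sub>2 + h\<^sub>3"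
    using s by linarith+
  \<comment> \<open>Of the three distances between points on a line, the largest is the sum of the
    other two.\<close>
  have tri: "\<bar>s\<^sub>1 - s\<^sub>2\<bar> = \<bar>s\<^sub>1 - s\<^sub>3\<bar> + \<bar>s\<^sub>2 - s\<^sub>3\<bar> \<or> \<bar>s\<^sub>1 - s\<^sub>3\<bar> = \<bar>s\<^sub>1 - s\<^sub>2\<bar> + \<bar>s\<^sub>2 - s\<^sub>3\<bar> \<or>
      \<bar>s\<^sub>2 - s\<^sub>3\<bar> = \<bar>s\<^sub>1 - s\<^sub>2\<bar> + \<bar>s\<^sub>1 - s\<^sub>3\<bar>" by linarith
  define r\<^sub>1\<^sub>2 r\<^sub>1\<^sub>3 r\<^sub>2\<^sub>3 where "r\<^sub>1\<^sub>2 = \<bar>s\<^sub>1 - s\<^sub>2\<bar>" "r\<^sub>1\<^sub>3 = \<bar>s\<^sub>1 - s\<^sub>3\<bar>" "r\<^sub>2\<^sub>3 = \<bar>s\<^sub>2 - s\<^sub>3\<bar>"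
  note r = this[symmetric]
  \<comment> \<open>If the outermost pair contains the first point, the lower bounds on the two
    inner distances exceed the upper bound on the outer one, because P > 4 c. So the outer pair is
    the second and third, and its upper bound \<open>h\<^sub>2 + h\<^sub>3\<close> yields the
    claim.\<close>
  show ?thesis unfolding eqs
    using 12[unfolded r] 13[unfolded r] 23[unfolded r] le[unfolded r] tri[unfolded r] h large' \<open>P \<le> Q\<close>
    by linarith
qed

section \<open>Both exponents on the logarithmic scale, reduced to primitive points\<close>

context irrational_padic
begin

definition approximable :: "real \<Rightarrow> bool" where
  "approximable m \<longleftrightarrow> infinite {(x::int, y::int). x \<noteq> 0 \<and> y \<noteq> 0 \<and>
     0 < padic_lin p \<xi> x y \<and> padic_lin p \<xi> x y \<le> sqrt \<bar>real_of_int (x * y)\<bar> powr (- m)}"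

definition uniformly_approximable :: "real \<Rightarrow> bool" where
  "uniformly_approximable w \<longleftrightarrow> (\<forall>\<^sub>F X::real in at_top. \<exists>x y::int.
     0 < sqrt \<bar>real_of_int (x * y)\<bar> \<and> sqrt \<bar>real_of_int (x * y)\<bar> \<le> X \<and>
     padic_lin p \<xi> x y \<le> X powr (- w))"

text \<open>What a solution at \<open>X = exp t\<close> leaves after division by its gcd \<open>k\<close>: the logarithm of the
  height drops by \<open>ln \<bar>k\<bar>\<close>, that of the linear form grows by at most \<open>ln \<bar>k\<bar>\<close>.\<close>

definition admissible :: "real \<Rightarrow> real \<Rightarrow> int \<Rightarrow> int \<Rightarrow> bool" where
  "admissible w t x y \<longleftrightarrow> x \<noteq> 0 \<and> y \<noteq> 0 \<and> coprime x y \<and> log_height x y \<le> t \<and>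
    log_lin x y + log_height x y \<le> (1 - w) * t"

lemma admissibleD:
  assumes "admissible w t x y"
  shows "x \<noteq> 0" "y \<noteq> 0" "coprime x y" "log_height x y \<le> t"
    "log_lin x y + log_height x y \<le> (1 - w) * t"
  using assms by (simp_all add: admissible_def)

lemma padic_lin_le_powr_iff:
  assumes "x \<noteq> 0" "y \<noteq> 0"
  shows "padic_lin p \<xi> x y \<le> exp t powr (- m) \<longleftrightarrow> log_lin x y \<le> - m * t"
  using assms by (simp add: padic_lin_eq_exp powr_def)

lemma approximable_iff:
  "approximable m \<longleftrightarrow> infinite {(x, y). x \<noteq> 0 \<and> y \<noteq> 0 \<and> log_lin x y \<le> - m * log_height x y}"
proof -
  have "x \<noteq> 0 \<and> y \<noteq> 0 \<and> 0 < padic_lin p \<xi> x y \<and>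
      padic_lin p \<xi> x y \<le> sqrt \<bar>real_of_int (x * y)\<bar> powr (- m) \<longleftrightarrow>
      x \<noteq> 0 \<and> y \<noteq> 0 \<and> log_lin x y \<le> - m * log_height x y" for x y
    using padic_lin_pos[of x y] sqrt_eq_exp_log_height[of x y]
      padic_lin_le_powr_iff[of x y "log_height x y" m] by metis
  then show ?thesis unfolding approximable_def by simp
qed

lemma log_lin_bounded_below:
  assumes "finite S"
  obtains c where "\<And>x y. (x, y) \<in> S \<Longrightarrow> c < log_lin x y"
proof -
  have "bdd_below (case_prod log_lin ` S)" using assms by simp
  then obtain c where c: "\<forall>z\<in>S. c \<le> case_prod log_lin z"
    unfolding bdd_below_def by auto
  have "c - 1 < log_lin x y" if "(x, y) \<in> S" for x y using c that by fastforce
  then show ?thesis by (rule that)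
qed

text \<open>Only finitely many points have height at most B, and on these the positive form is
  bounded below.\<close>

lemma log_height_large:
  obtains c where "\<And>x y. x \<noteq> 0 \<Longrightarrow> y \<noteq> 0 \<Longrightarrow> log_lin x y \<le> c \<Longrightarrow> B < log_height x y"
proof -
  obtain c where c: "\<And>x y. x \<noteq> 0 \<Longrightarrow> y \<noteq> 0 \<Longrightarrow> log_height x y \<le> B \<Longrightarrow> c < log_lin x y"
    by (rule log_lin_bounded_below[OF finite_log_height_le[of B]]) auto
  have "B < log_height x y" if "x \<noteq> 0" "y \<noteq> 0" "log_lin x y \<le> c" for x y
    using c[OF that(1,2)] that(3) by linarith
  then show ?thesis by (rule that)
qed

text \<open>Finitely many solutions would bound the form away from 0.\<close>

lemma approximableI:
  assumes ex: "\<And>c. \<exists>x y. x \<noteq> 0 \<and> y \<noteq> 0 \<and> log_lin x y \<le> c \<and> log_lin x y \<le> - m * log_height x y"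
  shows "approximable m"
  unfolding approximable_iff
proof
  assume "finite {(x, y). x \<noteq> 0 \<and> y \<noteq> 0 \<and> log_lin x y \<le> - m * log_height x y}"
  then obtain c where
    "\<And>x y. x \<noteq> 0 \<Longrightarrow> y \<noteq> 0 \<Longrightarrow> log_lin x y \<le> - m * log_height x y \<Longrightarrow> c < log_lin x y"
    by (rule log_lin_bounded_below) auto
  then show False using ex[of c] by (meson not_less)
qed

text \<open>The gap m' - m absorbs the constant C once the height exceeds C / (m' - m).\<close>

lemma approximableI_less:
  assumes "m < m'"
    and ex: "\<And>c. \<exists>x y. x \<noteq> 0 \<and> y \<noteq> 0 \<and> log_lin x y \<le> c \<and> log_lin x y \<le> C - m' * log_height x y"
  shows "approximable m"
proof (rule approximableI)
  fix c
  obtain c' where c':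
    "\<And>x y. x \<noteq> 0 \<Longrightarrow> y \<noteq> 0 \<Longrightarrow> log_lin x y \<le> c' \<Longrightarrow> C / (m' - m) < log_height x y"
    using log_height_large by blast
  obtain x y where xy: "x \<noteq> 0" "y \<noteq> 0" "log_lin x y \<le> min c c'"
      "log_lin x y \<le> C - m' * log_height x y"
    using ex[of "min c c'"] by blast
  then have "C < (m' - m) * log_height x y"
    using c'[of x y] assms(1) by (simp add: field_simps)
  then have "log_lin x y \<le> - m * log_height x y" using xy(4) by (simp add: algebra_simps)
  then show "\<exists>x y. x \<noteq> 0 \<and> y \<noteq> 0 \<and> log_lin x y \<le> c \<and> log_lin x y \<le> - m * log_height x y"
    using xy by auto
qed

text \<open>Infinitely many solutions could a priori be multiples of a few primitive points. For m >
  1 the form of the primitive point still tends to 0, so its height is unbounded too.\<close>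

lemma approximableE:
  assumes "approximable m" "1 < m"
  obtains x y where "x \<noteq> 0" "y \<noteq> 0" "coprime x y" "B < log_height x y"
    "log_lin x y \<le> - m * log_height x y"
proof -
  obtain c where c: "\<And>x y. x \<noteq> 0 \<Longrightarrow> y \<noteq> 0 \<Longrightarrow> log_lin x y \<le> c \<Longrightarrow> B < log_height x y"
    using log_height_large by blast
  have "\<not> {(x, y). x \<noteq> 0 \<and> y \<noteq> 0 \<and> log_lin x y \<le> - m * log_height x y} \<subseteq>
      {(x, y). x \<noteq> 0 \<and> y \<noteq> 0 \<and> log_height x y \<le> - c / (m - 1)}"
    using finite_log_height_le assms(1) finite_subset unfolding approximable_iff by blast
  then obtain x y where xy: "x \<noteq> 0" "y \<noteq> 0" "log_lin x y \<le> - m * log_height x y"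
    "- c / (m - 1) < log_height x y" by fastforce
  obtain k a b where k: "k \<noteq> 0" "a \<noteq> 0" "b \<noteq> 0" "coprime a b" "x = k * a" "y = k * b"
    using gcd_decompose[OF xy(1,2)] by blast
  let ?k = "ln \<bar>real_of_int k\<bar>"
  have h: "log_height x y = ?k + log_height a b" using k log_height_scale by simp
  have l: "log_lin a b \<le> ?k + log_lin x y" using k log_lin_le_scale by simp
  have "?k \<le> log_height x y" using h log_height_nonneg[of a b] by simp
  then have "log_lin a b \<le> (1 - m) * log_height x y" using l xy(3) by (simp add: algebra_simps)
  also have "\<dots> \<le> c" using xy(4) assms(2) by (simp add: field_simps)
  finally have "B < log_height a b" using c k by blast
  \<comment> \<open>Division by k costs ln |k| in the form but gains m ln |k| on the right-hand
    side.\<close>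
  moreover have "0 \<le> (m - 1) * ?k" using assms(2) ln_abs_int_nonneg by simp
  then have "log_lin a b \<le> - m * log_height a b"
    using l xy(3) unfolding h by (simp add: algebra_simps)
  ultimately show ?thesis using that k by blast
qed

lemma uniformly_approximableE:
  assumes "uniformly_approximable w"
  obtains t\<^sub>0 where "\<forall>t\<ge>t\<^sub>0. \<exists>x y. admissible w t x y"
proof -
  obtain X\<^sub>0 where X\<^sub>0: "\<And>X. X\<^sub>0 \<le> X \<Longrightarrow> \<exists>x y. 0 < sqrt \<bar>real_of_int (x * y)\<bar> \<and>
      sqrt \<bar>real_of_int (x * y)\<bar> \<le> X \<and> padic_lin p \<xi> x y \<le> X powr (- w)"
    using assms unfolding uniformly_approximable_def eventually_at_top_linorder by blast
  have "\<exists>x y. admissible w t x y" if t: "ln (max X\<^sub>0 1) \<le> t" for t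
  proof -
    have "exp (ln (max X\<^sub>0 1)) \<le> exp t" using t by (simp only: exp_le_cancel_iff)
    then have "X\<^sub>0 \<le> exp t" by simp
    then obtain x y where xy: "0 < sqrt \<bar>real_of_int (x * y)\<bar>"
      "sqrt \<bar>real_of_int (x * y)\<bar> \<le> exp t" "padic_lin p \<xi> x y \<le> exp t powr (- w)"
      using X\<^sub>0 by blast
    then have nz: "x \<noteq> 0" "y \<noteq> 0" by auto
    have h: "log_height x y \<le> t" using xy(2) sqrt_eq_exp_log_height[OF nz] by simp
    have l: "log_lin x y \<le> - w * t" using xy(3) padic_lin_le_powr_iff[OF nz] by simp
    obtain k a b where k: "k \<noteq> 0" "a \<noteq> 0" "b \<noteq> 0" "coprime a b" "x = k * a" "y = k * b"
      using gcd_decompose[OF nz] by blast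
    let ?k = "ln \<bar>real_of_int k\<bar>"
    have hk: "log_height x y = ?k + log_height a b" using k log_height_scale by simp
    have "log_lin a b \<le> ?k + log_lin x y" using k log_lin_le_scale by simp
    then have "log_lin a b + log_height a b \<le> (1 - w) * t"
      using h l hk by (simp add: algebra_simps)
    moreover have "log_height a b \<le> t" using h hk ln_abs_int_nonneg[of k] by simp
    ultimately show ?thesis using k unfolding admissible_def by blast
  qed
  then show ?thesis using that by blast
qed

text \<open>A solution at t has height at most t, hence is one at its own height; letting t grow
  makes the form arbitrarily small.\<close>

lemma uniformly_approximable_imp_approximable:
  assumes "uniformly_approximable w" "1 < w"
  shows "approximable w"
proof (rule approximableI)
  fix c
  obtain t\<^sub>0 where t\<^sub>0: "\<forall>t\<ge>t\<^sub>0. \<exists>x y. admissible w t x y"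
    using uniformly_approximableE[OF assms(1)] .
  define t where "t = max t\<^sub>0 (- c / (w - 1))"
  have "t\<^sub>0 \<le> t" by (simp add: t_def)
  then obtain x y where "admissible w t x y" using t\<^sub>0 by blast
  note xy = admissibleD[OF this]
  have "- c / (w - 1) \<le> t" by (simp add: t_def)
  then have "(1 - w) * t \<le> c" using assms(2) by (simp add: field_simps)
  then have "log_lin x y \<le> c" using xy(5) log_height_nonneg[of x y] by linarith
  moreover have "(1 - w) * t \<le> (1 - w) * log_height x y"
    using xy(4) assms(2) by (intro mult_left_mono_neg) auto
  then have "log_lin x y \<le> - w * log_height x y" using xy(5) by (simp add: algebra_simps)
  ultimately show "\<exists>x y. x \<noteq> 0 \<and> y \<noteq> 0 \<and> log_lin x y \<le> c \<and> log_lin x y \<le> - w * log_height x y"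
    using xy(1,2) by blast
qed

text \<open>The quality of (x, y) gives (m - 1) h <= (w - 1) t, the determinant gives (w - 3) t <= 2
  ln 2 + h. Eliminating t and taking h large yields (w - 3) (m - 1) <= w - 1, which is the
  claim.\<close>

lemma exponent_product_le_of_large:
  assumes w: "uniformly_approximable w" "3 < w" and m: "approximable m" "w \<le> m"
  shows "(w - 3) * (m - 2) \<le> 2"
proof (rule ccontr)
  assume "\<not> (w - 3) * (m - 2) \<le> 2"
  then have d: "0 < (w - 3) * (m - 1) - (w - 1)" by (simp add: algebra_simps)
  obtain t\<^sub>0 where t\<^sub>0: "\<forall>t\<ge>t\<^sub>0. \<exists>x y. admissible w t x y"
    using uniformly_approximableE[OF w(1)] .
  have "1 < m" using w(2) m(2) by simp
  have ln2: "0 < ln (2::real)" by simp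
  obtain x y where xy: "x \<noteq> 0" "y \<noteq> 0" "coprime x y"
      "max t\<^sub>0 ((w - 1) * (2 * ln 2) / ((w - 3) * (m - 1) - (w - 1))) < log_height x y"
      "log_lin x y \<le> - m * log_height x y"
    using approximableE[OF m(1) \<open>1 < m\<close>] .
  define h where "h = log_height x y"
  have h: "t\<^sub>0 < h" "(w - 1) * (2 * ln 2) < ((w - 3) * (m - 1) - (w - 1)) * h"
    using xy(4) d by (simp_all add: h_def field_simps)
  have "0 \<le> h" by (simp add: h_def log_height_nonneg)
  text \<open>At \<open>X = exp t\<close> the multiples of \<open>(x, y)\<close> have just ceased to be solutions.\<close>
  define t where "t = (ln 2 - log_lin x y - h) / (w - 1)"
  have t: "(w - 1) * t = ln 2 - log_lin x y - h" using w(2) by (simp add: t_def)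
  have "(m - 1) * h = m * h - h" by (simp add: algebra_simps)
  then have mt: "(m - 1) * h \<le> (w - 1) * t"
    unfolding t using xy(5) ln2 unfolding h_def by linarith
  have "(w - 1) * h \<le> (m - 1) * h" using m(2) \<open>0 \<le> h\<close> by (intro mult_right_mono) auto
  then have "(w - 1) * h \<le> (w - 1) * t" using mt by linarith
  then have "h \<le> t" using w(2) by simp
  have "t\<^sub>0 \<le> t" using h(1) \<open>h \<le> t\<close> by simp
  then obtain x' y' where "admissible w t x' y'" using t\<^sub>0 by blast
  note xy' = admissibleD[OF this]
  have wt: "(1 - w) * t = - ((w - 1) * t)" by (simp add: algebra_simps)
  \<comment> \<open>The summand ln 2 in t makes this strict, which forces independence.\<close>
  have "log_lin x' y' + log_height x' y' < log_lin x y + log_height x y"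
    using xy'(5) ln2 unfolding wt t h_def by linarith
  then have "x * y' \<noteq> x' * y" using coprime_dependent[OF xy(3) xy'(3) xy(1,2)] by force
  from log_det[OF xy(1,2) xy'(1,2) this]
  have "0 \<le> ln 2 + 2 * h + 2 * log_height x' y' + max (log_lin x y) (log_lin x' y')"
    using abs_log_slope_le[of x y] abs_log_slope_le[of x' y'] unfolding h_def by linarith
  \<comment> \<open>When the second form attains the maximum, this needs h <= t, which came from w
    <= m.\<close>
  then have "(w - 1) * t \<le> 2 * ln 2 + h + 2 * t"
    using xy'(4,5) \<open>h \<le> t\<close> ln2 unfolding wt t by linarith
  then have "(w - 3) * t \<le> 2 * ln 2 + h" by (simp add: algebra_simps)
  then have "(w - 1) * ((w - 3) * t) \<le> (w - 1) * (2 * ln 2 + h)"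
    using w(2) by (intro mult_left_mono) auto
  moreover have "(w - 3) * ((m - 1) * h) \<le> (w - 3) * ((w - 1) * t)"
    using mt w(2) by (intro mult_left_mono) auto
  ultimately show False using h(2) by (simp add: algebra_simps)
qed

text \<open>If m < w, the larger exponent w is itself approximable and can replace m.\<close>

lemma exponent_product_le:
  assumes w: "uniformly_approximable w" "3 < w" and m: "approximable m"
  shows "(w - 3) * (m - 2) \<le> 2"
proof (cases "w \<le> m")
  case True
  then show ?thesis using exponent_product_le_of_large assms by blast
next
  case False
  then have "(w - 3) * (m - 2) \<le> (w - 3) * (w - 2)" using w(2) by (intro mult_left_mono) auto
  moreover have "(w - 3) * (w - 2) \<le> 2"
    using exponent_product_le_of_large[OF w] uniformly_approximable_imp_approximable[OF w(1)] w(2) by simp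
  ultimately show ?thesis by linarith
qed

text \<open>The second point is the good approximation: (w - 2) \<open>t\<^sub>2\<close> <=
  \<open>t\<^sub>3\<close> + 2 ln 2 bounds its form through the definition of
  \<open>t\<^sub>3\<close>, and (w - 1) (w - 2) + 1 = w^2 - 3 w + 3.\<close>

lemma approximable_of_uniformly_approximable:
  assumes w: "uniformly_approximable w" "3 < w" and m: "m < w\<^sup>2 - 3 * w + 3"
  shows "approximable m"
proof (rule approximableI_less[OF m])
  fix c :: real
  obtain t\<^sub>0 where t\<^sub>0: "\<forall>t\<ge>t\<^sub>0. \<exists>x y. admissible w t x y"
    using uniformly_approximableE[OF w(1)] .
  have neg: "(1 - w) * t = - ((w - 1) * t)" for t by (simp add: algebra_simps)
  have ln2: "0 < ln (2::real)" by simp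
  \<comment> \<open>The entry with c makes the form of the second point at most c; the last one
    provides the strict inequality 4 ln 2 < (w - 3) \<open>t\<^sub>2\<close> for
    \<open>three_points_arith\<close>.\<close>
  define t\<^sub>1 where "t\<^sub>1 = Max {t\<^sub>0, 0, - c / (w - 1), (4 * ln 2 + 1) / (w - 3)}"
  have t\<^sub>1: "t\<^sub>0 \<le> t\<^sub>1" "0 \<le> t\<^sub>1" "- c / (w - 1) \<le> t\<^sub>1" "(4 * ln 2 + 1) / (w - 3) \<le> t\<^sub>1"
    unfolding t\<^sub>1_def by simp_all
  obtain x\<^sub>1 y\<^sub>1 where "admissible w t\<^sub>1 x\<^sub>1 y\<^sub>1"
    using t\<^sub>0 t\<^sub>1(1) by blast
  note 1 = admissibleD[OF this]
  define t\<^sub>2 where "t\<^sub>2 = (ln 2 - log_lin x\<^sub>1 y\<^sub>1 - log_height x\<^sub>1 y\<^sub>1) / (w - 1)"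
  have t\<^sub>2: "(w - 1) * t\<^sub>2 = ln 2 - log_lin x\<^sub>1 y\<^sub>1 - log_height x\<^sub>1 y\<^sub>1"
    using w(2) by (simp add: t\<^sub>2_def)
  have "(w - 1) * t\<^sub>1 \<le> (w - 1) * t\<^sub>2" using 1(5) ln2 unfolding neg t\<^sub>2 by linarith
  then have t12: "t\<^sub>1 \<le> t\<^sub>2" using w(2) by simp
  then obtain x\<^sub>2 y\<^sub>2 where "admissible w t\<^sub>2 x\<^sub>2 y\<^sub>2"
    using t\<^sub>0 t\<^sub>1(1) by (meson order_trans)
  note 2 = admissibleD[OF this]
  define t\<^sub>3 where "t\<^sub>3 = (ln 2 - log_lin x\<^sub>2 y\<^sub>2 - log_height x\<^sub>2 y\<^sub>2) / (w - 1)"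
  have t\<^sub>3: "(w - 1) * t\<^sub>3 = ln 2 - log_lin x\<^sub>2 y\<^sub>2 - log_height x\<^sub>2 y\<^sub>2"
    using w(2) by (simp add: t\<^sub>3_def)
  have "(w - 1) * t\<^sub>2 \<le> (w - 1) * t\<^sub>3" using 2(5) ln2 unfolding neg t\<^sub>3 by linarith
  then have t23: "t\<^sub>2 \<le> t\<^sub>3" using w(2) by simp
  then obtain x\<^sub>3 y\<^sub>3 where "admissible w t\<^sub>3 x\<^sub>3 y\<^sub>3"
    using t\<^sub>0 t\<^sub>1(1) t12 by (meson order_trans)
  note 3 = admissibleD[OF this]
  have lt: "log_lin x\<^sub>2 y\<^sub>2 + log_height x\<^sub>2 y\<^sub>2 < log_lin x\<^sub>1 y\<^sub>1 + log_height x\<^sub>1 y\<^sub>1"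
    "log_lin x\<^sub>3 y\<^sub>3 + log_height x\<^sub>3 y\<^sub>3 < log_lin x\<^sub>2 y\<^sub>2 + log_height x\<^sub>2 y\<^sub>2"
    using 2(5) 3(5) ln2 unfolding neg t\<^sub>2 t\<^sub>3 by linarith+
  have "x\<^sub>1 * y\<^sub>2 \<noteq> x\<^sub>2 * y\<^sub>1" "x\<^sub>1 * y\<^sub>3 \<noteq> x\<^sub>3 * y\<^sub>1" "x\<^sub>2 * y\<^sub>3 \<noteq> x\<^sub>3 * y\<^sub>2"
    using coprime_dependent[OF 1(3) 2(3) 1(1,2)] coprime_dependent[OF 1(3) 3(3) 1(1,2)]
      coprime_dependent[OF 2(3) 3(3) 2(1,2)] lt by force+
  note det = log_det[OF 1(1,2) 2(1,2) this(1)] log_det[OF 1(1,2) 3(1,2) this(2)]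
    log_det[OF 2(1,2) 3(1,2) this(3)]
  have "4 * ln 2 < (w - 3) * t\<^sub>1" using t\<^sub>1(4) w(2) by (simp add: field_simps)
  moreover have "(w - 3) * t\<^sub>1 \<le> (w - 3) * t\<^sub>2" using t12 w(2) by (intro mult_left_mono) auto
  ultimately have large: "4 * ln 2 < (w - 3) * t\<^sub>2" by linarith
  have "(w - 3 + 1) * t\<^sub>2 \<le> log_height x\<^sub>3 y\<^sub>3 + 2 * ln 2"
    by (rule three_points_arith[OF abs_log_slope_le abs_log_slope_le abs_log_slope_le _ 2(4) 3(4) t23
        _ _ _ _ det _ _ large])
      (use 1(4) 2(5) 3(5) t12 t\<^sub>2 t\<^sub>3 w(2) in \<open>simp_all add: neg\<close>)
  then have "(w - 2) * t\<^sub>2 \<le> t\<^sub>3 + 2 * ln 2" using 3(4) by simp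
  moreover have "(w - 2) * log_height x\<^sub>2 y\<^sub>2 \<le> (w - 2) * t\<^sub>2"
    using 2(4) w(2) by (intro mult_left_mono) auto
  ultimately have "(w - 2) * log_height x\<^sub>2 y\<^sub>2 \<le> t\<^sub>3 + 2 * ln 2" by linarith
  then have "(w - 1) * ((w - 2) * log_height x\<^sub>2 y\<^sub>2) \<le> (w - 1) * (t\<^sub>3 + 2 * ln 2)"
    using w(2) by (intro mult_left_mono) auto
  then have "log_lin x\<^sub>2 y\<^sub>2 \<le> ln 2 + (w - 1) * (2 * ln 2) - (w\<^sup>2 - 3 * w + 3) * log_height x\<^sub>2 y\<^sub>2"
    using t\<^sub>3 by (simp add: algebra_simps power2_eq_square)
  moreover have "- c \<le> (w - 1) * t\<^sub>1" using t\<^sub>1(3) w(2) by (simp add: field_simps)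
  then have "log_lin x\<^sub>2 y\<^sub>2 \<le> c"
    using 1(5) lt(1) log_height_nonneg[of x\<^sub>2 y\<^sub>2] unfolding neg by linarith
  ultimately show "\<exists>x y. x \<noteq> 0 \<and> y \<noteq> 0 \<and> log_lin x y \<le> c \<and>
      log_lin x y \<le> ln 2 + (w - 1) * (2 * ln 2) - (w\<^sup>2 - 3 * w + 3) * log_height x y"
    using 2(1,2) by blast
qed

end


section \<open>Pigeonhole lower bound for the uniform exponent\<close>

text \<open>Thue's argument: the box holds (N + 1)^2 > M pairs, so two of them share a residue; take
  their difference.\<close>

lemma small_solution_of_congruence:
  fixes a b :: int and M N :: nat
  assumes "0 < M" "M < (N + 1)\<^sup>2"
  obtains x y where "x \<noteq> 0 \<or> y \<noteq> 0" "\<bar>x\<bar> \<le> int N" "\<bar>y\<bar> \<le> int N" "int M dvd y * a - x * b"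
proof -
  let ?A = "{0..int N} \<times> {0..int N}" and ?f = "\<lambda>(x, y). (y * a - x * b) mod int M"
  have "card (?f ` ?A) \<le> card {0..<int M}"
    by (rule card_mono) (use assms(1) in auto)
  also have "\<dots> < card ?A" using assms(2) by (simp add: power2_eq_square nat_add_distrib)
  finally have "\<not> inj_on ?f ?A" by (rule pigeonhole)
  then obtain x y x' y' where xy: "(x, y) \<in> ?A" "(x', y') \<in> ?A" "(x, y) \<noteq> (x', y')"
    "?f (x, y) = ?f (x', y')"
    unfolding inj_on_def by blast
  have "int M dvd (y * a - x * b) - (y' * a - x' * b)"
    using xy(4) by (simp add: mod_eq_dvd_iff)
  then have "int M dvd (y - y') * a - (x - x') * b" by (simp add: algebra_simps)
  moreover have "x - x' \<noteq> 0 \<or> y - y' \<noteq> 0" "\<bar>x - x'\<bar> \<le> int N" "\<bar>y - y'\<bar> \<le> int N"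
    using xy(1-3) by auto
  ultimately show ?thesis using that by blast
qed

text \<open>The right-hand side is max |b|_p |a|_p, and p cannot divide both a and b. It serves to
  cancel the denominator of a rational approximation to \<xi>.\<close>

lemma padic_abs_denominator:
  assumes "prime p" "coprime a b" "b \<noteq> 0"
  shows "1 \<le> padic_abs p (of_int b) * max 1 (padic_abs p (of_int a / of_int b))"
proof -
  have unit: "padic_abs p (of_int c) = 1" if "\<not> int p dvd c" for c
  proof -
    have "c \<noteq> 0" using that by auto
    with that show ?thesis
      by (simp add: padic_abs_of_int[OF assms(1)] not_dvd_imp_multiplicity_0)
  qed
  have b: "padic_abs p (of_int b) > 0"
    using padic_abs_eq_0_iff[OF assms(1), of "of_int b"] assms(3) padic_abs_nonneg[of p "of_int b"]
    by (simp add: less_le)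
  show ?thesis
  proof (cases "int p dvd b")
    case True
    have "\<not> int p dvd a"
    proof
      assume "int p dvd a"
      then have "is_unit (int p)" using True assms(2) coprime_common_divisor by blast
      then show False using assms(1) not_prime_unit by auto
    qed
    then have "padic_abs p (of_int a / of_int b) = 1 / padic_abs p (of_int b)"
      by (simp add: divide_inverse padic_abs_mult[OF assms(1)] padic_abs_inverse[OF assms(1)] unit)
    then have "1 = padic_abs p (of_int b) * padic_abs p (of_int a / of_int b)" using b by simp
    also have "\<dots> \<le> padic_abs p (of_int b) * max 1 (padic_abs p (of_int a / of_int b))"
      using b by (intro mult_left_mono) auto
    finally show ?thesis .
  qed (simp add: unit)
qed

context irrational_padic
begin

text \<open>A term a / b of a Cauchy sequence for \<xi> replaces \<xi> to precision p^(-n), and the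
  congruence y a = x b modulo p^n is solved in the box. In C, the factor p comes from rounding N^2
  down to a power of p, and max 1 B from clearing b.\<close>

lemma Dirichlet:
  obtains C where "0 < C" "\<And>N. 1 \<le> N \<Longrightarrow> \<exists>x y. (x \<noteq> 0 \<or> y \<noteq> 0) \<and> \<bar>x\<bar> \<le> int N \<and> \<bar>y\<bar> \<le> int N \<and>
    padic_lin p \<xi> x y \<le> C / (real N)\<^sup>2"
proof -
  obtain s where s: "s \<in> \<xi>" "padic_Cauchy p s" by (rule \<xi>_representative)
  obtain B where B: "B > 0" "\<And>n. padic_abs p (s n) \<le> B"
    using padic_Cauchy_bounded[OF prime s(2)] by blast
  have p2: "2 \<le> p" using prime_ge_2_nat[OF prime] .
  have "\<exists>x y. (x \<noteq> 0 \<or> y \<noteq> 0) \<and> \<bar>x\<bar> \<le> int N \<and> \<bar>y\<bar> \<le> int N \<and>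
      padic_lin p \<xi> x y \<le> (max 1 B * real p) / (real N)\<^sup>2" if N: "1 \<le> N" for N
  proof -
    obtain n where n: "p ^ n \<le> N\<^sup>2" "N\<^sup>2 < p ^ (n + 1)"
      using ex_power_ivl1[OF p2, of "N\<^sup>2"] N by auto
    have pn: "0 < real p ^ n" using p2 by simp
    then obtain i where i: "\<And>j. j \<ge> i \<Longrightarrow> padic_abs p (s j - s i) < 1 / real p ^ n"
      using s(2) unfolding padic_Cauchy_def by (metis divide_pos_pos order_refl zero_less_one)
    obtain a b where ab: "quotient_of (s i) = (a, b)" by (cases "quotient_of (s i)")
    have b: "b > 0" "coprime a b" and si: "s i = of_int a / of_int b"
      using quotient_of_denom_pos[OF ab] quotient_of_coprime[OF ab] quotient_of_div[OF ab] by auto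
    have "p ^ n < (N + 1)\<^sup>2"
      using n(1) by (rule order.strict_trans1) (simp add: power2_eq_square)
    then obtain x y where xy: "x \<noteq> 0 \<or> y \<noteq> 0" "\<bar>x\<bar> \<le> int N" "\<bar>y\<bar> \<le> int N"
      "int (p ^ n) dvd y * a - x * b"
      using small_solution_of_congruence[of "p ^ n" N a b] p2 by auto
    let ?b = "padic_abs p (of_int b)"
    have "max 1 (padic_abs p (s i)) \<le> max 1 B" using B(2)[of i] by simp
    then have "?b * max 1 (padic_abs p (s i)) \<le> ?b * max 1 B" by (intro mult_left_mono) auto
    then have bB: "1 \<le> ?b * max 1 B"
      using padic_abs_denominator[OF prime b(2)] b(1) unfolding si by simp
    have "of_int b * (of_int y * s i - of_int x) = of_int (y * a - x * b)"
      using b(1) by (simp add: si right_diff_distrib)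
    then have "?b * padic_abs p (of_int y * s i - of_int x) = padic_abs p (of_int (y * a - x * b))"
      by (simp only: flip: padic_abs_mult[OF prime])
    also have "\<dots> \<le> 1 / real p ^ n"
      using padic_abs_of_int_power_dvd[OF prime, of n "y * a - x * b"] xy(4)
      by (simp only: of_nat_power)
    finally have le: "?b * padic_abs p (of_int y * s i - of_int x) \<le> 1 / real p ^ n" .
    have "padic_abs p (of_int y * s i - of_int x) \<le>
        (?b * max 1 B) * padic_abs p (of_int y * s i - of_int x)"
      using bB mult_right_mono[OF bB padic_abs_nonneg] by simp
    also have "\<dots> = max 1 B * (?b * padic_abs p (of_int y * s i - of_int x))" by simp
    also have "\<dots> \<le> max 1 B * (1 / real p ^ n)" using le by (intro mult_left_mono) auto
    finally have 1: "padic_abs p (of_int y * s i - of_int x) \<le> max 1 B / real p ^ n" by simp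
    have "padic_abs p (of_int y * s j - of_int x) \<le> max 1 B / real p ^ n" if "j \<ge> i" for j
    proof -
      have "padic_abs p (of_int y * (s j - s i)) \<le> 1 * (1 / real p ^ n)"
        unfolding padic_abs_mult[OF prime]
        using i[OF that] padic_abs_of_int_le_1[OF prime, of y] by (intro mult_mono) auto
      also have "\<dots> \<le> max 1 B / real p ^ n" using pn by (simp add: divide_right_mono)
      finally have 2: "padic_abs p (of_int y * (s j - s i)) \<le> max 1 B / real p ^ n" .
      have eq: "of_int y * s j - of_int x = of_int y * (s j - s i) + (of_int y * s i - of_int x)"
        by (simp add: algebra_simps)
      show ?thesis unfolding eq
        using padic_abs_add[OF prime, of "of_int y * (s j - s i)" "of_int y * s i - of_int x"] 1 2
        by linarith
    qed
    then have "padic_lin p \<xi> x y \<le> max 1 B / real p ^ n"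
      by (intro LIMSEQ_le_const2[OF padic_lin_tendsto[OF prime \<xi>_carrier s(1)]]) blast
    also have "\<dots> = max 1 B * real p / real (p ^ (n + 1))" using p2 by simp
    also have "\<dots> \<le> max 1 B * real p / (real N)\<^sup>2"
    proof (rule divide_left_mono)
      show "(real N)\<^sup>2 \<le> real (p ^ (n + 1))" using n(2) by (simp only: of_nat_le_iff flip: of_nat_power)
    qed (use N p2 in auto)
    finally show ?thesis using xy by blast
  qed
  then show ?thesis by (intro that[of "max 1 B * real p"]) (use p2 in auto)
qed

text \<open>Take N as the integer part of X. The Dirichlet point might lie on an axis, but there the
  form is at least \<delta> / N, which beats C / N^2 for large N.\<close>

lemma uniformly_approximable_less_2:
  assumes "m < 2"
  shows "uniformly_approximable m"
proof -
  obtain C where C: "0 < C" "\<And>N. 1 \<le> N \<Longrightarrow> \<exists>x y. (x \<noteq> 0 \<or> y \<noteq> 0) \<and> \<bar>x\<bar> \<le> int N \<and> \<bar>y\<bar> \<le> int N \<and>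
    padic_lin p \<xi> x y \<le> C / (real N)\<^sup>2" by (rule Dirichlet) blast
  define \<delta> where "\<delta> = min 1 (padic_lin p \<xi> 0 1)"
  have \<delta>: "0 < \<delta>" "\<delta> \<le> 1" "\<delta> \<le> padic_lin p \<xi> 0 1" using padic_lin_pos[of 0 1] by (auto simp: \<delta>_def)
  \<comment> \<open>With X <= 2 N, the second entry gives C / \<delta> < N, and the third gives C /
    N^2 <= 4 C / X^2 <= X powr (- m).\<close>
  define X\<^sub>0 where "X\<^sub>0 = Max {1, 2 * C / \<delta> + 1, (4 * C) powr (1 / (2 - m))}"
  have X\<^sub>0: "1 \<le> X\<^sub>0" "2 * C / \<delta> + 1 \<le> X\<^sub>0" "(4 * C) powr (1 / (2 - m)) \<le> X\<^sub>0"
    by (simp_all add: X\<^sub>0_def)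
  have "\<exists>x y. 0 < sqrt \<bar>real_of_int (x * y)\<bar> \<and> sqrt \<bar>real_of_int (x * y)\<bar> \<le> X \<and>
      padic_lin p \<xi> x y \<le> X powr (- m)" if X: "X\<^sub>0 \<le> X" for X
  proof -
    define N where "N = nat \<lfloor>X\<rfloor>"
    have X1: "1 \<le> X" using X X\<^sub>0(1) by linarith
    have "1 \<le> \<lfloor>X\<rfloor>" using X1 by simp
    then have "int N = \<lfloor>X\<rfloor>" "1 \<le> int N" unfolding N_def by linarith+
    then have N: "1 \<le> N" "real N \<le> X" "X \<le> 2 * real N" by linarith+
    obtain x y where xy: "x \<noteq> 0 \<or> y \<noteq> 0" "\<bar>x\<bar> \<le> int N" "\<bar>y\<bar> \<le> int N"
      "padic_lin p \<xi> x y \<le> C / (real N)\<^sup>2" using C(2)[OF N(1)] by blast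
    have "C / \<delta> < real N" using X X\<^sub>0(2) N(3) by linarith
    then have "C < \<delta> * real N" using \<delta>(1) by (simp add: field_simps)
    then have "C / (real N)\<^sup>2 < \<delta> / real N" using N(1) by (simp add: field_simps power2_eq_square)
    then have small: "padic_lin p \<xi> x y < \<delta> / real N" using xy(4) by linarith
    have ge: "1 / real N \<le> padic_abs p (of_int z)" if "z \<noteq> 0" "\<bar>z\<bar> \<le> int N" for z
    proof -
      have "real_of_int \<bar>z\<bar> \<le> real N" using that(2) by linarith
      then have "1 / real N \<le> 1 / real_of_int \<bar>z\<bar>" using that(1) by (intro divide_left_mono) auto
      then show ?thesis using padic_abs_of_int_ge[OF prime that(1)] by linarith
    qed
    have "y \<noteq> 0"
    proof
      assume "y = 0"
      then have "1 / real N < \<delta> / real N" using small ge[of x] xy by (simp add: padic_lin_0_right)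
      then show False using \<delta>(2) N(1) by (simp add: divide_less_cancel)
    qed
    have "x \<noteq> 0"
    proof
      assume "x = 0"
      have "1 / real N * \<delta> \<le> padic_abs p (of_int y) * padic_lin p \<xi> 0 1"
        using ge[OF \<open>y \<noteq> 0\<close> xy(3)] \<delta> by (intro mult_mono) auto
      then show False using small \<open>x = 0\<close> padic_lin_scale[of y 0 1] by simp
    qed
    have "\<bar>x * y\<bar> \<le> int N * int N" unfolding abs_mult using xy by (intro mult_mono) auto
    then have "real_of_int \<bar>x * y\<bar> \<le> real_of_int (int N * int N)" by (simp only: of_int_le_iff)
    then have "\<bar>real_of_int (x * y)\<bar> \<le> real N * real N" by simp
    then have "sqrt \<bar>real_of_int (x * y)\<bar> \<le> sqrt ((real N)\<^sup>2)"
      by (intro real_sqrt_le_mono) (simp add: power2_eq_square)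
    then have "sqrt \<bar>real_of_int (x * y)\<bar> \<le> X" using N(2) by simp
    moreover have "0 < sqrt \<bar>real_of_int (x * y)\<bar>" using \<open>x \<noteq> 0\<close> \<open>y \<noteq> 0\<close> by simp
    moreover have "padic_lin p \<xi> x y \<le> X powr (- m)"
    proof -
      have "((4 * C) powr (1 / (2 - m))) powr (2 - m) \<le> X powr (2 - m)"
        using X X\<^sub>0(3) assms by (intro powr_mono2) auto
      then have C4: "4 * C \<le> X powr (2 - m)" using assms C(1) by (simp add: powr_powr)
      have "X\<^sup>2 \<le> (2 * real N)\<^sup>2" using N(3) X1 by (intro power_mono) auto
      then have "C / (real N)\<^sup>2 \<le> 4 * C / X\<^sup>2"
        using C(1) N(1) X1 by (simp add: field_simps)
      also have "\<dots> \<le> X powr (2 - m) / X\<^sup>2" using C4 by (intro divide_right_mono) auto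
      also have "\<dots> = X powr (- m)"
        using X1 by (simp add: powr_diff powr_minus field_simps)
      finally show ?thesis using xy(4) by linarith
    qed
    ultimately show ?thesis by blast
  qed
  then show ?thesis unfolding uniformly_approximable_def eventually_at_top_linorder by blast
qed


section \<open>Passage to the suprema\<close>

lemma mu_times_eq: "mu_times p \<xi> = Sup (ereal ` {m. approximable m})"
  by (simp add: mu_times_def approximable_def)

lemma mu_hat_times_eq: "mu_hat_times p \<xi> = Sup (ereal ` {w. uniformly_approximable w})"
  by (simp add: mu_hat_times_def uniformly_approximable_def)

lemma le_mu_times: "approximable m \<Longrightarrow> ereal m \<le> mu_times p \<xi>"
  unfolding mu_times_eq by (intro Sup_upper) simp

lemma mu_hat_times_leI: "(\<And>w. uniformly_approximable w \<Longrightarrow> ereal w \<le> B) \<Longrightarrow> mu_hat_times p \<xi> \<le> B"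
  unfolding mu_hat_times_eq by (intro Sup_least) auto

text \<open>Ensures that both exponents are at least 2, so the denominator in the first inequality
  is never negative.\<close>

lemma mu_hat_times_ge_2: "2 \<le> mu_hat_times p \<xi>"
proof (rule dense_le)
  fix z :: ereal
  assume "z < 2"
  then show "z \<le> mu_hat_times p \<xi>"
  proof (cases z)
    case (real r)
    then have "uniformly_approximable r"
      using \<open>z < 2\<close> by (intro uniformly_approximable_less_2) simp
    then show ?thesis unfolding mu_hat_times_eq real by (intro Sup_upper) simp
  qed auto
qed

lemma mu_hat_times_le_mu_times: "mu_hat_times p \<xi> \<le> mu_times p \<xi>"
proof (rule mu_hat_times_leI)
  fix w assume w: "uniformly_approximable w"
  \<comment> \<open>Passing to the ordinary exponent requires more than 1; any number strictly
    between 1 and 2 would do for 3 / 2.\<close>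
  have "uniformly_approximable (max w (3 / 2))"
    using w uniformly_approximable_less_2[of "3 / 2"] by (simp add: max_def)
  then have "ereal (max w (3 / 2)) \<le> mu_times p \<xi>"
    by (intro le_mu_times uniformly_approximable_imp_approximable) auto
  then show "ereal w \<le> mu_times p \<xi>" by (rule order_trans[rotated]) simp
qed

lemma uniformly_approximable_le:
  assumes w: "uniformly_approximable w"
  shows "w \<le> (5 + sqrt 5) / 2"
proof (cases "3 < w")
  case True
  \<comment> \<open>The second inequality supplies only exponents strictly below w^2 - 3 w + 3, so
    the bound for that value follows by density.\<close>
  have "m \<le> 2 + 2 / (w - 3)" if "m < w\<^sup>2 - 3 * w + 3" for m
    using exponent_product_le[OF w True approximable_of_uniformly_approximable[OF w True that]] True
    by (simp add: field_simps)
  then have "w\<^sup>2 - 3 * w + 3 \<le> 2 + 2 / (w - 3)" by (rule dense_le)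
  then have "(w\<^sup>2 - 3 * w + 3) * (w - 3) \<le> 2 * (w - 3) + 2" using True by (simp add: field_simps)
  then have "(w - 1) * (w\<^sup>2 - 5 * w + 5) \<le> 0"
    by (simp add: algebra_simps power2_eq_square)
  then have "w\<^sup>2 - 5 * w + 5 \<le> 0" using True by (simp add: mult_le_0_iff)
  then have "(2 * w - 5)\<^sup>2 \<le> 5" by (simp add: algebra_simps power2_eq_square)
  then have "2 * w - 5 \<le> sqrt 5" by (rule real_le_rsqrt)
  then show ?thesis by simp
next
  case False
  have "1 \<le> sqrt (5::real)" by simp
  then have "2 * w \<le> 5 + sqrt 5" using False by linarith
  then show ?thesis by simp
qed

text \<open>The third bound comes first: with the lower bound 2 it makes the uniform exponent a real
  v, so that only the ordinary exponent may be infinite.\<close>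

lemma exponent_bounds:
  "mu_hat_times p \<xi> \<le> 3 + 2 / (mu_times p \<xi> - 2)"
  "(mu_hat_times p \<xi>)\<^sup>2 - 3 * mu_hat_times p \<xi> + 3 \<le> mu_times p \<xi>"
  "mu_hat_times p \<xi> \<le> ereal ((5 + sqrt 5) / 2)"
proof -
  show le: "mu_hat_times p \<xi> \<le> ereal ((5 + sqrt 5) / 2)"
    by (rule mu_hat_times_leI) (simp only: ereal_less_eq uniformly_approximable_le)
  obtain v where v: "mu_hat_times p \<xi> = ereal v"
    using le mu_hat_times_ge_2 by (cases "mu_hat_times p \<xi>") auto
  have "2 \<le> v" using mu_hat_times_ge_2 v by simp
  have vle: "v \<le> B" if "\<And>w. uniformly_approximable w \<Longrightarrow> w \<le> B" for B
    using mu_hat_times_leI[of "ereal B"] that v by simp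
  show "mu_hat_times p \<xi> \<le> 3 + 2 / (mu_times p \<xi> - 2)"
  proof (cases "mu_times p \<xi>")
    case PInf
    have "w \<le> 3" if w: "uniformly_approximable w" for w
    proof (rule ccontr)
      assume w3: "\<not> w \<le> 3"
      have "mu_times p \<xi> \<le> ereal (2 + 2 / (w - 3))"
        unfolding mu_times_eq
        by (rule Sup_least) (use exponent_product_le[OF w] w3 in \<open>auto simp: field_simps\<close>)
      then show False using PInf by simp
    qed
    then show ?thesis using vle[of 3] v PInf by simp
  next
    case (real u)
    then have "2 \<le> u" using mu_hat_times_le_mu_times v \<open>2 \<le> v\<close> by simp
    show ?thesis
    proof (cases "u = 2")
      case True
      \<comment> \<open>Here the right-hand side is infinite, by 2 / 0 = \<infinity>.\<close>
      then show ?thesis using real v by (simp add: divide_ereal_def)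
    next
      case False
      have "w \<le> 3 + 2 / (u - 2)" if w: "uniformly_approximable w" for w
      proof (cases "3 < w")
        case True
        have "mu_times p \<xi> \<le> ereal (2 + 2 / (w - 3))"
          unfolding mu_times_eq
          by (rule Sup_least) (use exponent_product_le[OF w] True in \<open>auto simp: field_simps\<close>)
        then have "u \<le> 2 + 2 / (w - 3)" using real by simp
        then show ?thesis using True False \<open>2 \<le> u\<close> by (simp add: field_simps)
      next
        case False
        moreover have "0 \<le> 2 / (u - 2)" using \<open>2 \<le> u\<close> by simp
        ultimately show ?thesis by linarith
      qed
      then have "v \<le> 3 + 2 / (u - 2)" by (rule vle)
      then show ?thesis using real v False by simp
    qed
  next
    case MInf
    then show ?thesis using mu_hat_times_le_mu_times v by simp
  qed
  show "(mu_hat_times p \<xi>)\<^sup>2 - 3 * mu_hat_times p \<xi> + 3 \<le> mu_times p \<xi>"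
  proof (cases "mu_times p \<xi>")
    case (real u)
    have "v \<le> u" using mu_hat_times_le_mu_times v real by simp
    have "v\<^sup>2 - 3 * v + 3 \<le> u"
    proof (cases "v \<le> 3")
      case True
      \<comment> \<open>Here v^2 - 3 v + 3 = v + (v - 1) (v - 3) <= v.\<close>
      then have "(v - 1) * (v - 3) \<le> 0" using \<open>2 \<le> v\<close> by (simp add: mult_le_0_iff)
      then show ?thesis using \<open>v \<le> u\<close> by (simp add: algebra_simps power2_eq_square)
    next
      case False
      \<comment> \<open>The quadratic inequality w^2 - 3 w + 3 <= u is solved for w so that it
        passes to the supremum v, and is squared back afterwards.\<close>
      have "w \<le> max 3 (3 / 2 + sqrt (u - 3 / 4))" if w: "uniformly_approximable w" for w
      proof (cases "3 < w")
        case True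
        have "m \<le> u" if "m < w\<^sup>2 - 3 * w + 3" for m
          using le_mu_times[OF approximable_of_uniformly_approximable[OF w True that]] real by simp
        then have "w\<^sup>2 - 3 * w + 3 \<le> u" by (rule dense_le)
        then have "(w - 3 / 2)\<^sup>2 \<le> u - 3 / 4" by (simp add: power2_eq_square field_simps)
        then have "w - 3 / 2 \<le> sqrt (u - 3 / 4)" by (rule real_le_rsqrt)
        then show ?thesis by simp
      qed simp
      then have "v \<le> max 3 (3 / 2 + sqrt (u - 3 / 4))" by (rule vle)
      then have "v - 3 / 2 \<le> sqrt (u - 3 / 4)" using False by simp
      then have "(v - 3 / 2)\<^sup>2 \<le> (sqrt (u - 3 / 4))\<^sup>2" using \<open>2 \<le> v\<close> by (intro power_mono) auto
      then show ?thesis using \<open>2 \<le> v\<close> \<open>v \<le> u\<close> by (simp add: power2_eq_square field_simps)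
    qed
    then show ?thesis using real v by simp
  qed (use mu_hat_times_le_mu_times v in auto)
qed

end

theorem theorem3p1:
  fixes p :: nat and \<xi> :: "(nat \<Rightarrow> rat) set"
  assumes "prime p" and "padic_irrational p \<xi>"
  shows "mu_hat_times p \<xi> \<le> 3 + 2 / (mu_times p \<xi> - 2) \<and>
    mu_times p \<xi> \<ge> (mu_hat_times p \<xi>)\<^sup>2 - 3 * mu_hat_times p \<xi> + 3 \<and>
    mu_hat_times p \<xi> \<le> ereal ((5 + sqrt 5) / 2)"
proof -
  interpret irrational_padic p \<xi> using assms by unfold_locales
  show ?thesis using exponent_bounds by blast
qed

end
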